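(* Let $\alpha>0$ and let $(z,u,p)$ be the exact solution triple of the optimality system $$-\Delta z-u=f \text{ in }\Omega,\quad z=0\text{ on }\partial\Omega;\qquad -\Delta p+z=g\text{ in }\Omega,\quad p=0\text{ on }\partial\Omega;\qquad \alpha u-p=0\text{ in }\Omega,$$ where $\Omega=(0,1)^2$. Suppose $\{z,u,p\}\subset C^6(\overline\Omega)$. Then the finite difference scheme $$F_h z_h-R_h u_h=R_h f_h,\qquad F_h p_h+R_h z_h=R_h g_h,\qquad \alpha u_h-p_h=0$$ has fourth-order accuracy with respect to the infinity norm: there is a constant $C>0$, independent of $h$, such that for every $h=1/N$ (integer $N\ge 2$) the solution $(z_h,u_h,p_h)$ of the scheme satisfies $$\|z-z_h\|_\infty\le Ch^4,\qquad \|u-u_h\|_\infty\le Ch^4,\qquad \|p-p_h\|_\infty\le Ch^4,$$ where $z,u,p$ are evaluated at the interior grid points.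
   Context: The system is the first-order optimality (KKT) system of minimizing $\frac12\int_\Omega (z-g)^2dx+\frac{\alpha}{2}\int_\Omega u^2dx$ over $u\in L^2(\Omega)$ subject to $-\Delta z=u+f$ in $\Omega$, $z=0$ on $\partial\Omega$, with $f,g\in L^2(\Omega)$; $p$ is the adjoint state. Under the stated regularity, $f$ and $g$ are identified with their continuous representatives on $\overline\Omega$. Grid: $h=1/N$, grid points $(x_i,y_j)=(ih,jh)$, $0\le i,j\le N$; $\Omega_h$ is the set of interior grid points ($1\le i,j\le N-1$). $z_h,u_h,p_h$ are grid functions on $\Omega_h$ (vectors), with the value $0$ used at boundary nodes. $f_h,g_h$ are the grid values of $f,g$. $\|v\|_\infty=\max_{1\le i,j\le N-1}|v_{ij}|$. $F_h$ (the 9-point discrete negative Laplacian) and $R_h$ (the averaging of the right-hand side) are given at interior nodes $1\le i,j\le N-1$ by the stencils $$F_h=\frac{1}{6h^2}\begin{bmatrix}-1&-4&-1\\-4&20&-4\\-1&-4&-1\end{bmatrix},\qquad R_h=\frac1{12}\begin{bmatrix}0&1&0\\1&8&1\\0&1&0\end{bmatrix},$$ e.g. $(R_hv)_{ij}=\frac1{12}(8v_{ij}+v_{i+1,j}+v_{i-1,j}+v_{i,j+1}+v_{i,j-1})$. Homogeneous Dirichlet boundary values are used when these stencils act on $z_h,u_h,p_h$; in $R_hf_h$ and $R_hg_h$ the stencil averages the values of the given functions $f$ and $g$ at the grid points (including boundary grid points where the stencil reaches them). *)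

theory Defs
  imports "HOL-Analysis.Analysis"
begin

definition unit_square :: "(real \<times> real) set" where
  "unit_square = {0<..<1} \<times> {0<..<1}"

text \<open>
  \<open>C_closure k S f\<close> says that \<open>f\<close> belongs to \<open>C\<^sup>k\<close> of the closure of the open set \<open>S\<close>: all iterated
  partial derivatives of order at most \<open>k\<close> exist in \<open>S\<close> and extend continuously to the closure.
  The witnesses \<open>fx\<close>, \<open>fy\<close> are the extended first partial derivatives.
\<close>

primrec C_closure :: "nat \<Rightarrow> (real \<times> real) set \<Rightarrow> (real \<times> real \<Rightarrow> real) \<Rightarrow> bool" where
  "C_closure 0 S f \<longleftrightarrow> continuous_on (closure S) f"
| "C_closure (Suc k) S f \<longleftrightarrow> continuous_on (closure S) f \<and>
     (\<exists>fx fy. C_closure k S fx \<and> C_closure k S fy \<and>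
        (\<forall>(x, y)\<in>S. ((\<lambda>s. f (s, y)) has_real_derivative fx (x, y)) (at x) \<and>
                    ((\<lambda>t. f (x, t)) has_real_derivative fy (x, y)) (at y)))"

definition laplacian :: "(real \<times> real \<Rightarrow> real) \<Rightarrow> real \<times> real \<Rightarrow> real" where
  "laplacian f = (\<lambda>(x, y). deriv (deriv (\<lambda>s. f (s, y))) x + deriv (deriv (\<lambda>t. f (x, t))) y)"

definition optimality_system ::
  "real \<Rightarrow> (real \<times> real \<Rightarrow> real) \<Rightarrow> (real \<times> real \<Rightarrow> real) \<Rightarrow>
   (real \<times> real \<Rightarrow> real) \<Rightarrow> (real \<times> real \<Rightarrow> real) \<Rightarrow> (real \<times> real \<Rightarrow> real) \<Rightarrow> bool" where
  "optimality_system \<alpha> f g z u p \<longleftrightarrow>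
     (\<forall>x\<in>unit_square. - laplacian z x - u x = f x) \<and> (\<forall>x\<in>frontier unit_square. z x = 0) \<and>
     (\<forall>x\<in>unit_square. - laplacian p x + z x = g x) \<and> (\<forall>x\<in>frontier unit_square. p x = 0) \<and>
     (\<forall>x\<in>unit_square. \<alpha> * u x - p x = 0)"

text \<open>
  Arrays of nodal values are functions of two indices; the node \<open>(i, j)\<close> is the point \<open>(i/N, j/N)\<close>.
  The grid functions on the interior nodes are the arrays vanishing at all other indices, which
  builds in the homogeneous Dirichlet values read by the stencils.
\<close>

type_synonym grid = "nat \<Rightarrow> nat \<Rightarrow> real"

definition grid_functions :: "nat \<Rightarrow> grid set" where
  "grid_functions N = {v. \<forall>i j. \<not> (i \<in> {1..N-1} \<and> j \<in> {1..N-1}) \<longrightarrow> v i j = 0}"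

definition grid_values :: "nat \<Rightarrow> (real \<times> real \<Rightarrow> real) \<Rightarrow> grid" where
  "grid_values N f i j = f (real i / real N, real j / real N)"

definition grid_norm :: "nat \<Rightarrow> grid \<Rightarrow> real" where
  "grid_norm N v = Max ((\<lambda>(i, j). \<bar>v i j\<bar>) ` ({1..N-1} \<times> {1..N-1}))"

text \<open>
  The stencils, with mesh size \<open>h = 1/N\<close>; they are only meaningful at interior nodes, where the
  truncated subtraction \<open>i - 1\<close> is harmless.
\<close>

definition F_h :: "nat \<Rightarrow> grid \<Rightarrow> grid" where
  "F_h N v i j =
     (20 * v i j
      - 4 * (v (i+1) j + v (i-1) j + v i (j+1) + v i (j-1))
      - (v (i+1) (j+1) + v (i+1) (j-1) + v (i-1) (j+1) + v (i-1) (j-1)))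
     / (6 * (1 / real N)^2)"

definition R_h :: "grid \<Rightarrow> grid" where
  "R_h v i j = (8 * v i j + v (i+1) j + v (i-1) j + v i (j+1) + v i (j-1)) / 12"

definition scheme_solution ::
  "nat \<Rightarrow> real \<Rightarrow> (real \<times> real \<Rightarrow> real) \<Rightarrow> (real \<times> real \<Rightarrow> real) \<Rightarrow> grid \<Rightarrow> grid \<Rightarrow> grid \<Rightarrow> bool" where
  "scheme_solution N \<alpha> f g z\<^sub>h u\<^sub>h p\<^sub>h \<longleftrightarrow>
     z\<^sub>h \<in> grid_functions N \<and> u\<^sub>h \<in> grid_functions N \<and> p\<^sub>h \<in> grid_functions N \<and>
     (\<forall>i\<in>{1..N-1}. \<forall>j\<in>{1..N-1}.
        F_h N z\<^sub>h i j - R_h u\<^sub>h i j = R_h (grid_values N f) i j \<and>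
        F_h N p\<^sub>h i j + R_h z\<^sub>h i j = R_h (grid_values N g) i j \<and>
        \<alpha> * u\<^sub>h i j - p\<^sub>h i j = 0)"

end

theory Submission
  imports Defs "Jordan_Normal_Form.Determinant"
begin

text \<open>
  The scheme is stable in the maximum norm and its truncation error is of order four; this gives
  both unique solvability and the error bound.

  \<^emph>\<open>Stability.\<close> Let \<open>A\<close> and \<open>B\<close> be the negative second differences in the two directions, without
  the factor \<open>1/h\<^sup>2\<close>, and \<open>L = A + B\<close>. Then \<open>F\<^sub>h = h\<^sup>-\<^sup>2 (L - AB/6)\<close> and \<open>R\<^sub>h = 1 - L/12\<close>. Test the
  two equations of the (error) system with \<open>\<alpha> L z\<close> and \<open>L p\<close> and add: since \<open>R\<^sub>h\<close> is a polynomial in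
  the symmetric operator \<open>L\<close>, the coupling terms \<open>-\<langle>R\<^sub>h p, L z\<rangle>\<close> and \<open>\<langle>R\<^sub>h z, L p\<rangle>\<close> cancel, whatever the
  size of \<open>\<alpha>\<close>. Because \<open>A\<close> and \<open>B\<close> have norm at most four and \<open>\<langle>A v, B v\<rangle>\<close> is a sum of squares,
  \<open>\<langle>(L - AB/6) v, L v\<rangle>\<close> is at least \<open>\<parallel>L v\<parallel>\<^sup>2 / 3\<close> (\<open>nine_point_coercive\<close>). So \<open>\<parallel>L z\<parallel>\<close> and \<open>\<parallel>L p\<parallel>\<close> are
  controlled by the residuals. That sum of squares runs over the mixed differences of \<open>v\<close>, and a value of
  \<open>v\<close> is a double sum of them; this turns a bound on \<open>\<parallel>L v\<parallel>\<close> into a bound on the maximum of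
  \<open>\<bar>v\<bar>\<close> (\<open>sup_bound_five_point\<close>), and \<open>scheme_stability\<close> follows. For zero residuals it says that the
  square linear system is injective, hence solvable.

  \<^emph>\<open>Consistency.\<close> By Taylor's formula the second difference \<open>\<delta>\<close> in the direction \<open>x\<close> satisfies
  \<open>\<delta> w = h\<^sup>2 (w\<^sub>x\<^sub>x + \<delta> w\<^sub>x\<^sub>x / 12) + O(h\<^sup>6)\<close>, and likewise for \<open>y\<close>. The cross term
  \<open>AB/6\<close> of the nine-point stencil supplies the mixed second differences of \<open>w\<^sub>x\<^sub>x\<close> and \<open>w\<^sub>y\<^sub>y\<close> which the
  average \<open>R\<^sub>h\<close> of the Laplacian contains, each with weight one twelfth. Hence
  \<open>F\<^sub>h w + R\<^sub>h \<Delta>w\<close> is of order \<open>h\<^sup>4\<close> (\<open>scheme_consistency\<close>). The differential equations hold up to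
  the boundary by continuity, so they express \<open>R\<^sub>h f\<close> and \<open>R\<^sub>h g\<close> through the exact solution, and the errors
  solve the scheme with right-hand sides of size \<open>h\<^sup>4\<close>.
\<close>

section \<open>Summation by parts and coercivity of the nine-point operator\<close>

text \<open>
  The mesh size is left out, so that all identities between stencils have rational coefficients; negative
  signs make the operators positive.
\<close>

definition neg_diff2_x :: "grid \<Rightarrow> grid" where
  "neg_diff2_x v i j = 2 * v i j - v (i+1) j - v (i-1) j"

definition neg_diff2_y :: "grid \<Rightarrow> grid" where
  "neg_diff2_y v i j = 2 * v i j - v i (j+1) - v i (j-1)"

definition five_point :: "grid \<Rightarrow> grid" where
  "five_point v i j = neg_diff2_x v i j + neg_diff2_y v i j"

definition grid_inner :: "nat \<Rightarrow> grid \<Rightarrow> grid \<Rightarrow> real" where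
  "grid_inner N v w = (\<Sum>i=1..N-1. \<Sum>j=1..N-1. v i j * w i j)"

lemma grid_functions_boundary:
  assumes "v \<in> grid_functions N"
  shows "v 0 j = 0" "v N j = 0" "v i 0 = 0" "v i N = 0"
proof -
  have "N \<notin> {1..N-1}" "0 \<notin> {1..N-1}" by auto
  then show "v 0 j = 0" "v N j = 0" "v i 0 = 0" "v i N = 0"
    using assms unfolding grid_functions_def by blast+
qed

lemma summation_by_parts:
  fixes x y :: "nat \<Rightarrow> real"
  assumes "N > 0" "y 0 = 0" "y N = 0"
  shows "(\<Sum>i=1..N-1. (2 * x i - x (i+1) - x (i-1)) * y i)
       = (\<Sum>i<N. (x (Suc i) - x i) * (y (Suc i) - y i))"
proof -
  have "(\<Sum>i=1..n. (2 * x i - x (i+1) - x (i-1)) * y i)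
      = (\<Sum>i<Suc n. (x (Suc i) - x i) * (y (Suc i) - y i)) - (x (Suc n) - x n) * y (Suc n)" for n
    using assms(2) by (induction n) (auto simp: algebra_simps)
  from this[of "N - 1"] show ?thesis using assms by simp
qed

text \<open>
  By parts the left side is \<open>\<Sum> (w (i+1) - w i)\<^sup>2\<close>, and \<open>(a - b)\<^sup>2 \<le> 2 a\<^sup>2 + 2 b\<^sup>2\<close> counts every
  value twice.
\<close>

lemma second_difference_bound:
  fixes w :: "nat \<Rightarrow> real"
  assumes "N > 0" "w 0 = 0" "w N = 0"
  shows "(\<Sum>i=1..N-1. (2 * w i - w (i+1) - w (i-1)) * w i) \<le> 4 * (\<Sum>i=1..N-1. (w i)\<^sup>2)"
proof -
  have ends: "(\<Sum>i<N. (w i)\<^sup>2) = (\<Sum>i=1..N-1. (w i)\<^sup>2)" "(\<Sum>i<N. (w (Suc i))\<^sup>2) = (\<Sum>i=1..N-1. (w i)\<^sup>2)"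
  proof -
    obtain n where n: "N = Suc n" using assms(1) by (cases N) auto
    show "(\<Sum>i<N. (w i)\<^sup>2) = (\<Sum>i=1..N-1. (w i)\<^sup>2)"
      unfolding n sum.lessThan_Suc_shift using assms(2)
      by (simp add: sum.atLeast1_atMost_eq)
    show "(\<Sum>i<N. (w (Suc i))\<^sup>2) = (\<Sum>i=1..N-1. (w i)\<^sup>2)"
      using assms(3) unfolding n by (simp add: sum.atLeast1_atMost_eq)
  qed
  have "(\<Sum>i=1..N-1. (2 * w i - w (i+1) - w (i-1)) * w i) = (\<Sum>i<N. (w (Suc i) - w i)\<^sup>2)"
    using summation_by_parts[OF assms] by (simp add: power2_eq_square)
  also have "\<dots> \<le> (\<Sum>i<N. 2 * (w (Suc i))\<^sup>2 + 2 * (w i)\<^sup>2)"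
  proof (rule sum_mono)
    fix i
    have "0 \<le> (w (Suc i) + w i)\<^sup>2" by simp
    then show "(w (Suc i) - w i)\<^sup>2 \<le> 2 * (w (Suc i))\<^sup>2 + 2 * (w i)\<^sup>2"
      by (simp add: power2_eq_square algebra_simps)
  qed
  also have "\<dots> = 4 * (\<Sum>i=1..N-1. (w i)\<^sup>2)"
    by (simp add: sum.distrib ends flip: sum_distrib_left)
  finally show ?thesis .
qed

lemma grid_inner_commute: "grid_inner N v w = grid_inner N w v"
  by (simp add: grid_inner_def mult.commute)

lemma grid_inner_nonneg: "0 \<le> grid_inner N v v"
  by (simp add: grid_inner_def sum_nonneg)

lemma grid_inner_combine:
  "grid_inner N (\<lambda>i j. a * v i j + b * w i j) y = a * grid_inner N v y + b * grid_inner N w y"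
  by (simp add: grid_inner_def sum.distrib sum_distrib_left algebra_simps)

lemma grid_inner_cong:
  assumes "\<And>i j. i \<in> {1..N-1} \<Longrightarrow> j \<in> {1..N-1} \<Longrightarrow> v i j = v' i j"
    and "\<And>i j. i \<in> {1..N-1} \<Longrightarrow> j \<in> {1..N-1} \<Longrightarrow> w i j = w' i j"
  shows "grid_inner N v w = grid_inner N v' w'"
  unfolding grid_inner_def using assms by (intro sum.cong) auto

lemma neg_diff2_symmetric:
  assumes "N > 0" "v \<in> grid_functions N" "w \<in> grid_functions N"
  shows "grid_inner N (neg_diff2_x v) w = grid_inner N v (neg_diff2_x w)"
    and "grid_inner N (neg_diff2_y v) w = grid_inner N v (neg_diff2_y w)"
proof -
  note bd = grid_functions_boundary[OF assms(2)] grid_functions_boundary[OF assms(3)]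
  have 1: "(\<Sum>i=1..N-1. (2 * x i - x (i+1) - x (i-1)) * y i) = (\<Sum>i=1..N-1. x i * (2 * y i - y (i+1) - y (i-1)))"
    if "x 0 = 0" "x N = 0" "y 0 = 0" "y N = 0" for x y :: "nat \<Rightarrow> real"
    using summation_by_parts[of N y x] summation_by_parts[of N x y] that assms(1)
    by (simp add: mult.commute)
  show "grid_inner N (neg_diff2_x v) w = grid_inner N v (neg_diff2_x w)"
    unfolding grid_inner_def neg_diff2_x_def
    by (subst sum.swap, subst (2) sum.swap, intro sum.cong refl 1) (use bd in auto)
  show "grid_inner N (neg_diff2_y v) w = grid_inner N v (neg_diff2_y w)"
    unfolding grid_inner_def neg_diff2_y_def
    by (intro sum.cong refl 1) (use bd in auto)
qed

lemma five_point_symmetric: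
  assumes "N > 0" "v \<in> grid_functions N" "w \<in> grid_functions N"
  shows "grid_inner N (five_point v) w = grid_inner N v (five_point w)"
proof -
  have "grid_inner N (five_point v) w = grid_inner N (neg_diff2_x v) w + grid_inner N (neg_diff2_y v) w" for v w
    using grid_inner_combine[of N 1 "neg_diff2_x v" 1 "neg_diff2_y v" w] by (simp add: five_point_def[abs_def])
  then show ?thesis
    using neg_diff2_symmetric[OF assms] by (metis grid_inner_commute)
qed

text \<open>
  Summation by parts in one direction and then in the other. There are no boundary
  terms: on the sides \<open>i = 0\<close> and \<open>i = N\<close> not only \<open>v\<close> but also its second difference along the side is zero.
\<close>

lemma mixed_difference_identity:
  assumes "N > 0" "v \<in> grid_functions N"
  shows "grid_inner N (neg_diff2_x v) (neg_diff2_y v)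
       = (\<Sum>i<N. \<Sum>j<N. (v (Suc i) (Suc j) - v i (Suc j) - v (Suc i) j + v i j)\<^sup>2)"
proof -
  note bd = grid_functions_boundary[OF assms(2)]
  have "grid_inner N (neg_diff2_x v) (neg_diff2_y v)
      = (\<Sum>j=1..N-1. \<Sum>i=1..N-1. (2 * v i j - v (i+1) j - v (i-1) j) * neg_diff2_y v i j)"
    unfolding grid_inner_def neg_diff2_x_def by (rule sum.swap)
  also have "\<dots> = (\<Sum>j=1..N-1. \<Sum>i<N. (v (Suc i) j - v i j) * (neg_diff2_y v (Suc i) j - neg_diff2_y v i j))"
    by (intro sum.cong refl summation_by_parts) (use bd assms in \<open>auto simp: neg_diff2_y_def\<close>)
  also have "\<dots> = (\<Sum>i<N. \<Sum>j=1..N-1. (2 * (v (Suc i) j - v i j) - (v (Suc i) (j+1) - v i (j+1))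
                    - (v (Suc i) (j-1) - v i (j-1))) * (v (Suc i) j - v i j))"
    by (subst sum.swap) (simp add: neg_diff2_y_def algebra_simps)
  also have "\<dots> = (\<Sum>i<N. \<Sum>j<N. ((v (Suc i) (Suc j) - v i (Suc j)) - (v (Suc i) j - v i j))
                    * ((v (Suc i) (Suc j) - v i (Suc j)) - (v (Suc i) j - v i j)))"
    by (intro sum.cong refl summation_by_parts[where x = "\<lambda>j. v (Suc _) j - v _ j"])
       (use bd assms in auto)
  finally show ?thesis
    by (simp add: power2_eq_square algebra_simps)
qed

text \<open>
  Starting from the sides \<open>i = 0\<close> and \<open>j = 0\<close>, where \<open>v\<close> vanishes, the value \<open>v i j\<close> is the sum of the
  mixed differences over the rectangle below it. The Cauchy-Schwarz inequality on at most \<open>N\<^sup>2\<close> cells does the rest.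
\<close>

lemma discrete_sobolev:
  assumes "N > 0" "v \<in> grid_functions N" "i \<le> N" "j \<le> N"
  shows "(v i j)\<^sup>2 \<le> (real N)\<^sup>2 * grid_inner N (neg_diff2_x v) (neg_diff2_y v)"
proof -
  note bd = grid_functions_boundary[OF assms(2)]
  define m where "m k l = v (Suc k) (Suc l) - v k (Suc l) - v (Suc k) l + v k l" for k l
  have col: "(\<Sum>l<j. m k l) = v (Suc k) j - v k j" for k
  proof -
    have "(\<Sum>l<j. m k l) = (\<Sum>l<j. (v (Suc k) (Suc l) - v k (Suc l)) - (v (Suc k) l - v k l))"
      by (simp add: m_def algebra_simps)
    also have "\<dots> = v (Suc k) j - v k j"
      by (subst sum_lessThan_telescope) (simp add: bd)
    finally show ?thesis .
  qed
  have "v i j = (\<Sum>k<i. \<Sum>l<j. m k l)"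
    unfolding col using sum_lessThan_telescope[of "\<lambda>k. v k j" i] by (simp add: bd)
  also have "\<dots> = (\<Sum>(k, l)\<in>{..<i} \<times> {..<j}. m k l)"
    by (simp add: sum.cartesian_product)
  finally have "(v i j)\<^sup>2 = (\<Sum>(k, l)\<in>{..<i} \<times> {..<j}. m k l)\<^sup>2" by simp
  also have "\<dots> \<le> (\<Sum>(k, l)\<in>{..<i} \<times> {..<j}. (m k l)\<^sup>2) * real (card ({..<i} \<times> {..<j}))"
    using sum_squared_le_sum_of_squares[of "\<lambda>(k, l). m k l" "{..<i} \<times> {..<j}"]
    by (simp add: case_prod_unfold)
  also have "\<dots> \<le> (\<Sum>(k, l)\<in>{..<N} \<times> {..<N}. (m k l)\<^sup>2) * (real N)\<^sup>2"
    using assms(3,4)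
    by (intro mult_mono sum_mono2) (auto simp: power2_eq_square intro!: mult_mono sum_nonneg)
  also have "\<dots> = (real N)\<^sup>2 * grid_inner N (neg_diff2_x v) (neg_diff2_y v)"
    unfolding mixed_difference_identity[OF assms(1,2)] m_def
    by (simp add: sum.cartesian_product)
  finally show ?thesis .
qed

lemma five_point_square:
  "grid_inner N (five_point v) (five_point v)
   = grid_inner N (neg_diff2_x v) (neg_diff2_x v) + 2 * grid_inner N (neg_diff2_x v) (neg_diff2_y v) + grid_inner N (neg_diff2_y v) (neg_diff2_y v)"
  by (simp add: grid_inner_def five_point_def algebra_simps sum.distrib sum_distrib_left)

text \<open>
  \<open>4 \<langle>a, b\<rangle> \<le> \<parallel>a + b\<parallel>\<^sup>2\<close> for the two directional differences \<open>a\<close> and \<open>b\<close>.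
\<close>

lemma sup_bound_five_point:
  assumes "N > 0" "v \<in> grid_functions N" "i \<le> N" "j \<le> N"
  shows "4 * (v i j)\<^sup>2 \<le> (real N)\<^sup>2 * grid_inner N (five_point v) (five_point v)"
proof -
  have "0 \<le> grid_inner N (\<lambda>i j. neg_diff2_x v i j - neg_diff2_y v i j) (\<lambda>i j. neg_diff2_x v i j - neg_diff2_y v i j)"
    by (rule grid_inner_nonneg)
  also have "\<dots> = grid_inner N (five_point v) (five_point v) - 4 * grid_inner N (neg_diff2_x v) (neg_diff2_y v)"
    by (simp add: grid_inner_def five_point_def algebra_simps sum.distrib sum_subtractf sum_distrib_left)
  finally have "(real N)\<^sup>2 * (4 * grid_inner N (neg_diff2_x v) (neg_diff2_y v))
      \<le> (real N)\<^sup>2 * grid_inner N (five_point v) (five_point v)"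
    by (intro mult_left_mono) auto
  then show ?thesis using discrete_sobolev[OF assms] by linarith
qed

text \<open>
  The scaled operator \<open>h\<^sup>2 F\<^sub>h\<close>, written so that its distance from the five-point operator is visible.
\<close>

definition nine_point :: "grid \<Rightarrow> grid" where
  "nine_point v i j = five_point v i j - neg_diff2_x (neg_diff2_y v) i j / 6"

text \<open>
  Write \<open>a\<close> and \<open>b\<close> for the directional second differences of \<open>v\<close>. The perturbation contributes at most
  \<open>4/6 (\<parallel>a\<parallel>\<^sup>2 + \<parallel>b\<parallel>\<^sup>2)\<close>, because \<open>a\<close> can be differenced in the direction \<open>y\<close> (it vanishes at the ends of
  each line \<open>i = const\<close>) and \<open>b\<close> in the direction \<open>x\<close>. As \<open>\<langle>a, b\<rangle> \<ge> 0\<close>, this is at most two thirds of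
  \<open>\<parallel>a + b\<parallel>\<^sup>2\<close>.
\<close>

lemma nine_point_coercive:
  assumes "N > 0" "v \<in> grid_functions N"
  shows "grid_inner N (five_point v) (five_point v) \<le> 3 * grid_inner N (nine_point v) (five_point v)"
proof -
  note bd = grid_functions_boundary[OF assms(2)]
  have x: "grid_inner N (neg_diff2_x (neg_diff2_y v)) (neg_diff2_y v) \<le> 4 * grid_inner N (neg_diff2_y v) (neg_diff2_y v)"
  proof -
    have "grid_inner N (neg_diff2_x (neg_diff2_y v)) (neg_diff2_y v) 
        = (\<Sum>j=1..N-1. \<Sum>i=1..N-1. (2 * neg_diff2_y v i j - neg_diff2_y v (i+1) j - neg_diff2_y v (i-1) j) * neg_diff2_y v i j)"
      unfolding grid_inner_def neg_diff2_x_def by (rule sum.swap)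
    also have "\<dots> \<le> (\<Sum>j=1..N-1. 4 * (\<Sum>i=1..N-1. (neg_diff2_y v i j)\<^sup>2))"
      by (intro sum_mono second_difference_bound) (use bd assms in \<open>auto simp: neg_diff2_y_def\<close>)
    also have "\<dots> = 4 * (\<Sum>i=1..N-1. \<Sum>j=1..N-1. (neg_diff2_y v i j)\<^sup>2)"
      by (subst sum.swap) (simp add: sum_distrib_left)
    finally show ?thesis by (simp add: grid_inner_def power2_eq_square)
  qed
  have y: "grid_inner N (neg_diff2_x (neg_diff2_y v)) (neg_diff2_x v) \<le> 4 * grid_inner N (neg_diff2_x v) (neg_diff2_x v)"
  proof -
    have "grid_inner N (neg_diff2_x (neg_diff2_y v)) (neg_diff2_x v) 
        = (\<Sum>i=1..N-1. \<Sum>j=1..N-1. (2 * neg_diff2_x v i j - neg_diff2_x v i (j+1) - neg_diff2_x v i (j-1)) * neg_diff2_x v i j)"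
      unfolding grid_inner_def by (simp add: neg_diff2_x_def neg_diff2_y_def algebra_simps)
    also have "\<dots> \<le> (\<Sum>i=1..N-1. 4 * (\<Sum>j=1..N-1. (neg_diff2_x v i j)\<^sup>2))"
      by (intro sum_mono second_difference_bound) (use bd assms in \<open>auto simp: neg_diff2_x_def\<close>)
    finally show ?thesis by (simp add: grid_inner_def power2_eq_square sum_distrib_left)
  qed
  have "grid_inner N (nine_point v) (five_point v) = grid_inner N (five_point v) (five_point v)
      - (grid_inner N (neg_diff2_x (neg_diff2_y v)) (neg_diff2_x v) + grid_inner N (neg_diff2_x (neg_diff2_y v)) (neg_diff2_y v)) / 6"
    by (simp add: grid_inner_def nine_point_def five_point_def algebra_simps sum.distrib sum_subtractf
        sum_distrib_left sum_divide_distrib add_divide_distrib)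
  moreover have "0 \<le> grid_inner N (neg_diff2_x v) (neg_diff2_y v)"
    unfolding mixed_difference_identity[OF assms] by (intro sum_nonneg) simp
  ultimately show ?thesis
    using x y five_point_square[of N v] by argo
qed

lemma F_h_nine_point:
  assumes "i \<ge> 1" "j \<ge> 1"
  shows "F_h N v i j = (real N)\<^sup>2 * nine_point v i j"
  using assms by (simp add: F_h_def nine_point_def five_point_def neg_diff2_x_def neg_diff2_y_def field_simps power2_eq_square)

lemma R_h_five_point: "R_h v i j = v i j - five_point v i j / 12"
  by (simp add: R_h_def five_point_def neg_diff2_x_def neg_diff2_y_def field_simps)

section \<open>Stability of the coupled scheme in the maximum norm\<close>

text \<open>
  The energy estimate behind the theorem. The first residual is tested with \<open>\<alpha> L z\<close>, the second with \<open>L p\<close>;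
  symmetry of \<open>L\<close> removes the coupling, and coercivity of the nine-point operator absorbs \<open>L z\<close> and \<open>L p\<close>. The
  result is independent of the mesh: the squared factor \<open>N\<^sup>2\<close> of \<open>F\<^sub>h\<close> pays for the sum of the squared residuals over fewer
  than \<open>N\<^sup>2\<close> nodes and for the factor \<open>N\<^sup>2\<close> in the bound of the maximum.
\<close>

lemma scheme_stability:
  assumes "\<alpha> > 0" "N > 0"
    and grid: "z \<in> grid_functions N" "u \<in> grid_functions N" "p \<in> grid_functions N"
    and state: "\<And>i j. i \<in> {1..N-1} \<Longrightarrow> j \<in> {1..N-1} \<Longrightarrow> \<bar>F_h N z i j - R_h u i j\<bar> \<le> T"
    and adjoint: "\<And>i j. i \<in> {1..N-1} \<Longrightarrow> j \<in> {1..N-1} \<Longrightarrow> \<bar>F_h N p i j + R_h z i j\<bar> \<le> T"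
    and gradient: "\<And>i j. i \<in> {1..N-1} \<Longrightarrow> j \<in> {1..N-1} \<Longrightarrow> \<alpha> * u i j = p i j"
    and "i \<le> N" "j \<le> N"
  shows "4 * \<alpha> * (z i j)\<^sup>2 \<le> 9 * (\<alpha> + 1) * T\<^sup>2"
    and "4 * (p i j)\<^sup>2 \<le> 9 * (\<alpha> + 1) * T\<^sup>2"
proof -
  let ?L = five_point
  define X where "X = grid_inner N (?L z) (?L z)"
  define Y where "Y = grid_inner N (?L p) (?L p)"
  define \<rho> where "\<rho> i j = F_h N z i j - R_h u i j" for i j
  define \<sigma> where "\<sigma> i j = F_h N p i j + R_h z i j" for i j
  have N2: "(real N)\<^sup>2 > 0" using assms by simp
  have XY: "0 \<le> X" "0 \<le> Y" unfolding X_def Y_def by (rule grid_inner_nonneg)+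
  have up: "\<alpha> * u i j = p i j" for i j
    using gradient grid(2,3) unfolding grid_functions_def by (cases "i \<in> {1..N-1} \<and> j \<in> {1..N-1}") auto
  have Rup: "\<alpha> * R_h u i j = R_h p i j" for i j
    by (simp add: R_h_def flip: up) (simp add: algebra_simps)
  \<comment> \<open>The coupling terms coincide, so they cancel in the tested sum.\<close>
  have sym: "grid_inner N (R_h p) (?L z) = grid_inner N (R_h z) (?L p)"
  proof -
    have R: "grid_inner N (R_h v) w = grid_inner N v w - grid_inner N (?L v) w / 12" for v w
      using grid_inner_combine[of N 1 v "-1/12" "?L v" w] by (simp add: R_h_five_point[abs_def])
    show ?thesis
      unfolding R using five_point_symmetric[OF \<open>N > 0\<close> grid(1,3)] by (metis grid_inner_commute)
  qed
  have F: "grid_inner N (F_h N v) w = (real N)\<^sup>2 * grid_inner N (nine_point v) w" for v w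
    by (subst grid_inner_cong[where v' = "\<lambda>i j. (real N)\<^sup>2 * nine_point v i j" and w' = w])
       (auto simp: F_h_nine_point grid_inner_def sum_distrib_left mult.assoc)
  have "\<alpha> * grid_inner N \<rho> (?L z) = \<alpha> * grid_inner N (F_h N z) (?L z) - grid_inner N (R_h p) (?L z)"
    by (simp add: grid_inner_def \<rho>_def sum_distrib_left sum_subtractf algebra_simps flip: Rup)
  moreover have "grid_inner N \<sigma> (?L p) = grid_inner N (F_h N p) (?L p) + grid_inner N (R_h z) (?L p)"
    by (simp add: grid_inner_def \<sigma>_def sum.distrib algebra_simps)
  ultimately have test: "\<alpha> * grid_inner N \<rho> (?L z) + grid_inner N \<sigma> (?L p)
      = (real N)\<^sup>2 * (\<alpha> * grid_inner N (nine_point z) (?L z) + grid_inner N (nine_point p) (?L p))"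
    unfolding F sym by (simp add: algebra_simps)
  have lower: "\<alpha> * X + Y \<le> 3 * (\<alpha> * grid_inner N (nine_point z) (?L z) + grid_inner N (nine_point p) (?L p))"
    using add_mono[OF mult_left_mono[OF nine_point_coercive[OF \<open>N > 0\<close> grid(1)], of \<alpha>]
        nine_point_coercive[OF \<open>N > 0\<close> grid(3)]] \<open>\<alpha> > 0\<close>
    by (simp add: X_def Y_def algebra_simps)
  have upper: "grid_inner N r w \<le> (real N)\<^sup>2 / 6 * grid_inner N w w + 3/2 * T\<^sup>2"
    if r: "\<And>i j. i \<in> {1..N-1} \<Longrightarrow> j \<in> {1..N-1} \<Longrightarrow> \<bar>r i j\<bar> \<le> T" for r w
  proof -
    \<comment> \<open>Young's inequality, weighted such that half of the coercivity constant \<open>N\<^sup>2/3\<close> is left over.\<close>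
    have young: "r i j * w i j \<le> (real N)\<^sup>2 / 6 * (w i j * w i j) + 3 / (2 * (real N)\<^sup>2) * T\<^sup>2"
      if "i \<in> {1..N-1}" "j \<in> {1..N-1}" for i j
    proof -
      have "a * b \<le> c / 6 * (b * b) + 3 / (2 * c) * a\<^sup>2" if "c > 0" for a b c :: real
      proof -
        have "0 \<le> (c * b - 3 * a)\<^sup>2 / (6 * c)" using that by simp
        also have "\<dots> = c / 6 * (b * b) + 3 / (2 * c) * a\<^sup>2 - a * b"
          using that by (simp add: field_simps power2_eq_square)
        finally show ?thesis by simp
      qed
      from this[OF N2]
      have "r i j * w i j \<le> (real N)\<^sup>2 / 6 * (w i j * w i j) + 3 / (2 * (real N)\<^sup>2) * (r i j)\<^sup>2" .
      moreover have "3 / (2 * (real N)\<^sup>2) * (r i j)\<^sup>2 \<le> 3 / (2 * (real N)\<^sup>2) * T\<^sup>2"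
        using power_mono[OF r[OF that], of 2] by (intro mult_left_mono) auto
      ultimately show ?thesis by linarith
    qed
    have "grid_inner N r w \<le> (\<Sum>i=1..N-1. \<Sum>j=1..N-1. (real N)\<^sup>2 / 6 * (w i j * w i j) + 3 / (2 * (real N)\<^sup>2) * T\<^sup>2)"
      unfolding grid_inner_def by (intro sum_mono young)
    also have "\<dots> = (real N)\<^sup>2 / 6 * grid_inner N w w + (real (N-1))\<^sup>2 * (3 / (2 * (real N)\<^sup>2) * T\<^sup>2)"
      by (simp add: grid_inner_def sum.distrib sum_distrib_left power2_eq_square mult.assoc)
    also have "(real (N-1))\<^sup>2 * (3 / (2 * (real N)\<^sup>2) * T\<^sup>2) \<le> (real N)\<^sup>2 * (3 / (2 * (real N)\<^sup>2) * T\<^sup>2)"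
      by (intro mult_right_mono power_mono) auto
    also have "\<dots> = 3/2 * T\<^sup>2" using N2 by (simp add: field_simps)
    finally show ?thesis by simp
  qed
  have "(real N)\<^sup>2 * (\<alpha> * X + Y) \<le> 3 * (\<alpha> * grid_inner N \<rho> (?L z) + grid_inner N \<sigma> (?L p))"
    using mult_left_mono[OF lower, of "(real N)\<^sup>2"] unfolding test by (simp add: algebra_simps)
  also have "\<dots> \<le> 3 * (\<alpha> * ((real N)\<^sup>2 / 6 * X + 3/2 * T\<^sup>2) + ((real N)\<^sup>2 / 6 * Y + 3/2 * T\<^sup>2))"
    unfolding X_def Y_def \<rho>_def \<sigma>_def using \<open>\<alpha> > 0\<close> state adjoint
    by (intro mult_left_mono add_mono upper) auto
  finally have energy: "(real N)\<^sup>2 * (\<alpha> * X) + (real N)\<^sup>2 * Y \<le> 9 * (\<alpha> + 1) * T\<^sup>2"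
    by (simp add: algebra_simps)
  have z: "4 * (z i j)\<^sup>2 \<le> (real N)\<^sup>2 * X" and p: "4 * (p i j)\<^sup>2 \<le> (real N)\<^sup>2 * Y"
    unfolding X_def Y_def using sup_bound_five_point[OF \<open>N > 0\<close> _ \<open>i \<le> N\<close> \<open>j \<le> N\<close>] grid by auto
  have "4 * \<alpha> * (z i j)\<^sup>2 \<le> (real N)\<^sup>2 * (\<alpha> * X)"
    using mult_left_mono[OF z, of \<alpha>] \<open>\<alpha> > 0\<close> by (simp add: algebra_simps)
  moreover have "0 \<le> (real N)\<^sup>2 * (\<alpha> * X)" "0 \<le> (real N)\<^sup>2 * Y"
    using XY \<open>\<alpha> > 0\<close> by auto
  ultimately show "4 * \<alpha> * (z i j)\<^sup>2 \<le> 9 * (\<alpha> + 1) * T\<^sup>2" "4 * (p i j)\<^sup>2 \<le> 9 * (\<alpha> + 1) * T\<^sup>2"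
    using energy p by linarith+
qed

lemma stencils_linear:
  "F_h N (\<lambda>i j. v i j + w i j) i j = F_h N v i j + F_h N w i j"
  "F_h N (\<lambda>i j. v i j - w i j) i j = F_h N v i j - F_h N w i j"
  "F_h N (\<lambda>i j. c * v i j) i j = c * F_h N v i j"
  "R_h (\<lambda>i j. v i j + w i j) i j = R_h v i j + R_h w i j"
  "R_h (\<lambda>i j. v i j - w i j) i j = R_h v i j - R_h w i j"
  "R_h (\<lambda>i j. c * v i j) i j = c * R_h v i j"
  by (simp_all add: F_h_def R_h_def algebra_simps flip: add_divide_distrib diff_divide_distrib)

section \<open>Unique solvability\<close>

text \<open>
  A square system with trivial kernel has a solution. Enumerating \<open>I\<close> turns \<open>T\<close> into a square matrix, whose
  determinant is nonzero because the kernel is trivial. The unknowns are functions vanishing outside \<open>I\<close>, in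
  the same way in which grid functions carry their boundary values.
\<close>

lemma injective_linear_system_solvable:
  fixes T :: "('a \<Rightarrow> real) \<Rightarrow> 'a \<Rightarrow> real" and b :: "'a \<Rightarrow> real"
  assumes fin: "finite I"
    and add: "\<And>x y i. T (\<lambda>k. x k + y k) i = T x i + T y i"
    and scale: "\<And>c x i. T (\<lambda>k. c * x k) i = c * T x i"
    and inj: "\<And>x. (\<forall>k. k \<notin> I \<longrightarrow> x k = 0) \<Longrightarrow> (\<forall>i\<in>I. T x i = 0) \<Longrightarrow> \<forall>k. x k = 0"
  shows "\<exists>x. (\<forall>k. k \<notin> I \<longrightarrow> x k = 0) \<and> (\<forall>i\<in>I. T x i = b i)"
proof -
  obtain e where e: "bij_betw e {0..<card I} I"
    using ex_bij_betw_nat_finite[OF fin] by blast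
  define n where "n = card I"
  define d where "d k l = (if k = l then 1 else 0 :: real)" for k l :: 'a
  define x_of where "x_of v = (\<lambda>k. \<Sum>c<n. vec_index v c * d k (e c))" for v :: "real vec"
  define A where "A = mat n n (\<lambda>(r, c). T (\<lambda>k. d k (e c)) (e r))"
  have A: "A \<in> carrier_mat n n" by (simp add: A_def)
  have T_sum: "T (\<lambda>k. \<Sum>c<m. f c * g k c) i = (\<Sum>c<m. f c * T (\<lambda>k. g k c) i)"
    for m :: nat and f :: "nat \<Rightarrow> real" and g i
    using scale[of 0 "\<lambda>_. 0"] by (induction m) (auto simp: add scale)
  have eI: "e c \<in> I" if "c < n" for c
    using e that by (auto simp: n_def bij_betw_def)
  have T_A: "T (x_of v) (e r) = vec_index (A *\<^sub>v v) r" if "r < n" "v \<in> carrier_vec n" for r v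
    using that unfolding x_of_def T_sum
    by (simp add: A_def scalar_prod_def mult.commute lessThan_atLeast0)
  have supp: "\<forall>k. k \<notin> I \<longrightarrow> x_of v k = 0" for v
    using eI by (auto simp: x_of_def d_def intro!: sum.neutral)
  have index: "\<exists>r<n. i = e r" if "i \<in> I" for i
    using e that by (force simp: n_def bij_betw_def)
  have coord: "x_of v (e r) = vec_index v r" if "r < n" for v r
  proof -
    have "d (e r) (e c) = (if r = c then 1 else 0)" if "c < n" for c
      using that \<open>r < n\<close> e unfolding d_def n_def
      by (auto simp: bij_betw_def inj_on_def)
    then show ?thesis using that by (simp add: x_of_def if_distrib[of "(*) _"] cong: if_cong)
  qed
  have "det A \<noteq> 0"
  proof
    assume "det A = 0"
    then obtain v where v: "v \<in> carrier_vec n" "v \<noteq> 0\<^sub>v n" "A *\<^sub>v v = 0\<^sub>v n"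
      using det_0_iff_vec_prod_zero_field[OF A] by blast
    have "\<forall>i\<in>I. T (x_of v) i = 0"
    proof
      fix i assume "i \<in> I"
      then obtain r where "r < n" "i = e r" using index by blast
      then show "T (x_of v) i = 0" using T_A[of r v] v by simp
    qed
    from inj[OF supp this] have "vec_index v r = 0" if "r < n" for r
      using coord[OF that] by metis
    then have "v = 0\<^sub>v n" using v(1) by (intro eq_vecI) auto
    with v(2) show False by simp
  qed
  from det_non_zero_imp_unit[OF A this, of "()"]
  obtain B where B: "B \<in> carrier_mat n n" "A * B = 1\<^sub>m n"
    by (auto simp: Units_def ring_mat_def)
  define v where "v = B *\<^sub>v vec n (\<lambda>r. b (e r))"
  have v: "v \<in> carrier_vec n" using B by (simp add: v_def)
  have "A *\<^sub>v v = vec n (\<lambda>r. b (e r))"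
    unfolding v_def using A B by (subst assoc_mult_mat_vec[symmetric, of _ n n _ n]) auto
  then have "\<forall>i\<in>I. T (x_of v) i = b i"
    using T_A[OF _ v] index by fastforce
  with supp show ?thesis by blast
qed

text \<open>
  Stability with residual zero shows that the homogeneous scheme has only the trivial solution, which gives
  uniqueness and, through linear algebra, existence. The control is eliminated as \<open>u = p/\<alpha>\<close>, and the two
  remaining grid functions are packed into one vector, the Boolean index telling \<open>z\<close> (false) from \<open>p\<close> (true).
\<close>

lemma scheme_uniquely_solvable:
  assumes "\<alpha> > 0" "N > 0"
  shows "\<exists>!(z\<^sub>h, u\<^sub>h, p\<^sub>h). scheme_solution N \<alpha> f g z\<^sub>h u\<^sub>h p\<^sub>h"
proof -
  have zero: "z = (\<lambda>i j. 0) \<and> p = (\<lambda>i j. 0)"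
    if "z \<in> grid_functions N" "u \<in> grid_functions N" "p \<in> grid_functions N"
      and "\<And>i j. i \<in> {1..N-1} \<Longrightarrow> j \<in> {1..N-1} \<Longrightarrow> F_h N z i j - R_h u i j = 0"
      and "\<And>i j. i \<in> {1..N-1} \<Longrightarrow> j \<in> {1..N-1} \<Longrightarrow> F_h N p i j + R_h z i j = 0"
      and "\<And>i j. i \<in> {1..N-1} \<Longrightarrow> j \<in> {1..N-1} \<Longrightarrow> \<alpha> * u i j = p i j" for z u p
  proof -
    have "z i j = 0 \<and> p i j = 0" for i j
    proof (cases "i \<in> {1..N-1} \<and> j \<in> {1..N-1}")
      case True
      then have "i \<le> N" "j \<le> N" by auto
      then have "4 * \<alpha> * (z i j)\<^sup>2 \<le> 0" "4 * (p i j)\<^sup>2 \<le> 0"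
        using scheme_stability[OF assms that(1-3), where T = 0] that(4-6) by auto
      then show ?thesis using assms(1) by (simp add: mult_le_0_iff)
    next
      case False
      with that(1,3) show ?thesis by (auto simp: grid_functions_def)
    qed
    then show ?thesis by auto
  qed
  define I where "I = (UNIV :: bool set) \<times> {1..N-1} \<times> {1..N-1}"
  define Z P U :: "(bool \<times> nat \<times> nat \<Rightarrow> real) \<Rightarrow> grid"
    where "Z x i j = x (False, i, j)" and "P x i j = x (True, i, j)" and "U x i j = 1 / \<alpha> * P x i j" for x i j
  define T where "T x = (\<lambda>(c, i, j). if c then F_h N (P x) i j + R_h (Z x) i j else F_h N (Z x) i j - R_h (U x) i j)" for x
  define b where "b = (\<lambda>(c, i, j). R_h (grid_values N (if c then g else f)) i j)"
  have mem: "Z x \<in> grid_functions N" "P x \<in> grid_functions N" "U x \<in> grid_functions N"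
    if "\<forall>k. k \<notin> I \<longrightarrow> x k = 0" for x
    using that by (auto simp: grid_functions_def Z_def P_def U_def I_def)
  have linear: "V (\<lambda>k. x k + y k) = (\<lambda>i j. V x i j + V y i j)" "V (\<lambda>k. c * x k) = (\<lambda>i j. c * V x i j)"
    if "V \<in> {Z, P, U}" for V x y c
    using that by (auto simp: fun_eq_iff Z_def P_def U_def add_divide_distrib)
  have "\<exists>x. (\<forall>k. k \<notin> I \<longrightarrow> x k = 0) \<and> (\<forall>i\<in>I. T x i = b i)"
  proof (rule injective_linear_system_solvable)
    show "finite I" by (simp add: I_def)
    show "T (\<lambda>k. x k + y k) i = T x i + T y i" for x y i
      by (cases i) (simp add: T_def linear stencils_linear algebra_simps)
    show "T (\<lambda>k. c * x k) i = c * T x i" for c x i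
      by (cases i) (simp add: T_def linear stencils_linear algebra_simps)
    fix x assume supp: "\<forall>k. k \<notin> I \<longrightarrow> x k = 0" and ker: "\<forall>i\<in>I. T x i = 0"
    have ker': "F_h N (Z x) i j - R_h (U x) i j = 0" "F_h N (P x) i j + R_h (Z x) i j = 0"
      if "i \<in> {1..N-1}" "j \<in> {1..N-1}" for i j
      using ker[rule_format, of "(False, i, j)"] ker[rule_format, of "(True, i, j)"] that
      by (auto simp: T_def I_def)
    have "Z x = (\<lambda>i j. 0) \<and> P x = (\<lambda>i j. 0)"
      by (rule zero[OF mem(1,3,2)]) (use supp ker' assms in \<open>auto simp: U_def\<close>)
    then have "x (c, i, j) = 0" for c i j
      by (cases c) (auto simp: Z_def P_def fun_eq_iff)
    then show "\<forall>k. x k = 0" by auto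
  qed
  then obtain x where x: "\<forall>k. k \<notin> I \<longrightarrow> x k = 0" "\<forall>i\<in>I. T x i = b i" by blast
  have "scheme_solution N \<alpha> f g (Z x) (U x) (P x)"
    unfolding scheme_solution_def
  proof (intro conjI ballI mem x(1))
    fix i j assume ij: "i \<in> {1..N-1}" "j \<in> {1..N-1}"
    show "F_h N (Z x) i j - R_h (U x) i j = R_h (grid_values N f) i j"
      using x(2)[rule_format, of "(False, i, j)"] ij by (simp add: T_def I_def b_def)
    show "F_h N (P x) i j + R_h (Z x) i j = R_h (grid_values N g) i j"
      using x(2)[rule_format, of "(True, i, j)"] ij by (simp add: T_def I_def b_def)
    show "\<alpha> * U x i j - P x i j = 0" using assms by (simp add: U_def)
  qed
  moreover have "z = z' \<and> u = u' \<and> p = p'"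
    if s: "scheme_solution N \<alpha> f g z u p" and s': "scheme_solution N \<alpha> f g z' u' p'" for z u p z' u' p'
  proof -
    let ?z = "\<lambda>i j. z i j - z' i j" and ?u = "\<lambda>i j. u i j - u' i j" and ?p = "\<lambda>i j. p i j - p' i j"
    have equations: "F_h N ?z i j - R_h ?u i j = 0" "F_h N ?p i j + R_h ?z i j = 0" "\<alpha> * ?u i j = ?p i j"
      if "i \<in> {1..N-1}" "j \<in> {1..N-1}" for i j
    proof -
      have "F_h N z i j - R_h u i j = F_h N z' i j - R_h u' i j"
        "F_h N p i j + R_h z i j = F_h N p' i j + R_h z' i j"
        "\<alpha> * u i j = p i j" "\<alpha> * u' i j = p' i j"
        using s s' that by (auto simp: scheme_solution_def)
      then show "F_h N ?z i j - R_h ?u i j = 0" "F_h N ?p i j + R_h ?z i j = 0" "\<alpha> * ?u i j = ?p i j"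
        by (simp_all add: stencils_linear right_diff_distrib)
    qed
    have "?z = (\<lambda>i j. 0) \<and> ?p = (\<lambda>i j. 0)"
      by (rule zero[OF _ _ _ equations])
         (use s s' in \<open>auto simp: scheme_solution_def grid_functions_def\<close>)
    then have zp: "z = z'" "p = p'" by (auto simp: fun_eq_iff)
    have "u i j = u' i j" for i j
    proof (cases "i \<in> {1..N-1} \<and> j \<in> {1..N-1}")
      case True
      then have "\<alpha> * u i j = \<alpha> * u' i j" using s s' zp by (auto simp: scheme_solution_def)
      then show ?thesis using assms(1) by simp
    next
      case False
      then show ?thesis using s s' by (auto simp: scheme_solution_def grid_functions_def)
    qed
    with zp show ?thesis by auto
  qed
  ultimately show ?thesis by (intro ex1I[of _ "(Z x, U x, P x)"]) auto
qed

section \<open>Second differences and Taylor expansion\<close>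

text \<open>
  Adding the expansions at \<open>x + h\<close> and \<open>x - h\<close> doubles the even terms and removes the odd ones.
\<close>

lemma central_Taylor:
  fixes \<phi> :: "nat \<Rightarrow> real \<Rightarrow> real"
  assumes "h > 0" "n > 0"
    and D: "\<And>m t. m < n \<Longrightarrow> x - h \<le> t \<Longrightarrow> t \<le> x + h \<Longrightarrow> (\<phi> m has_real_derivative \<phi> (Suc m) t) (at t)"
    and M: "\<And>t. x - h \<le> t \<Longrightarrow> t \<le> x + h \<Longrightarrow> \<bar>\<phi> n t\<bar> \<le> M"
  shows "\<bar>\<phi> 0 (x + h) + \<phi> 0 (x - h) - (\<Sum>m<n. (1 + (-1)^m) * \<phi> m x / fact m * h^m)\<bar> \<le> 2 * M / fact n * h^n"
proof -
  have remainder: "\<bar>\<phi> 0 (x + d) - (\<Sum>m<n. \<phi> m x / fact m * d^m)\<bar> \<le> M / fact n * h^n"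
    if d: "d = h \<or> d = - h" for d
  proof -
    obtain t where t: "if x + d < x then x + d < t \<and> t < x else x < t \<and> t < x + d"
      "\<phi> 0 (x + d) = (\<Sum>m<n. \<phi> m x / fact m * (x + d - x)^m) + \<phi> n t / fact n * (x + d - x)^n"
      using Taylor[of n \<phi> "\<phi> 0" "x - h" "x + h" x "x + d"] assms(1,2) D d by auto
    have "\<bar>\<phi> n t\<bar> \<le> M" using t(1) d assms(1) by (intro M) (auto split: if_splits)
    then have "\<bar>\<phi> n t / fact n * d^n\<bar> \<le> M / fact n * h^n"
      using d assms(1) by (auto simp: abs_mult power_abs intro!: mult_right_mono divide_right_mono)
    with t(2) show ?thesis by simp
  qed
  have "(\<Sum>m<n. (1 + (-1)^m) * \<phi> m x / fact m * h^m)
      = (\<Sum>m<n. \<phi> m x / fact m * h^m) + (\<Sum>m<n. \<phi> m x / fact m * (-h)^m)"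
    by (simp add: sum.distrib[symmetric] power_minus[of h] add_divide_distrib algebra_simps)
  then show ?thesis using remainder[of h] remainder[of "-h"] by simp
qed

lemma second_difference_estimates:
  fixes \<phi> :: "nat \<Rightarrow> real \<Rightarrow> real"
  assumes "h > 0"
    and D: "\<And>m t. m < n \<Longrightarrow> x - h \<le> t \<Longrightarrow> t \<le> x + h \<Longrightarrow> (\<phi> m has_real_derivative \<phi> (Suc m) t) (at t)"
    and M: "\<And>t. x - h \<le> t \<Longrightarrow> t \<le> x + h \<Longrightarrow> \<bar>\<phi> n t\<bar> \<le> M"
  shows "n = 2 \<Longrightarrow> \<bar>\<phi> 0 (x + h) - 2 * \<phi> 0 x + \<phi> 0 (x - h)\<bar> \<le> M * h^2"
    and "n = 4 \<Longrightarrow> \<bar>\<phi> 0 (x + h) - 2 * \<phi> 0 x + \<phi> 0 (x - h) - h^2 * \<phi> 2 x\<bar> \<le> M / 12 * h^4"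
    and "n = 6 \<Longrightarrow> \<bar>\<phi> 0 (x + h) - 2 * \<phi> 0 x + \<phi> 0 (x - h) - h^2 * \<phi> 2 x - h^4 / 12 * \<phi> 4 x\<bar> \<le> M / 360 * h^6"
proof -
  note T = central_Taylor[of h n x \<phi> M, OF assms(1) _ D M]
  show "\<bar>\<phi> 0 (x + h) - 2 * \<phi> 0 x + \<phi> 0 (x - h)\<bar> \<le> M * h^2" if "n = 2"
    using T that by (simp add: numeral_eq_Suc algebra_simps)
  show "\<bar>\<phi> 0 (x + h) - 2 * \<phi> 0 x + \<phi> 0 (x - h) - h^2 * \<phi> 2 x\<bar> \<le> M / 12 * h^4" if "n = 4"
  proof -
    have "(\<Sum>m<4. (1 + (-1)^m) * \<phi> m x / fact m * h^m) = 2 * \<phi> 0 x + h^2 * \<phi> 2 x"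
      by (simp add: eval_nat_numeral)
    then show ?thesis using T that by (simp add: fact_numeral algebra_simps)
  qed
  show "\<bar>\<phi> 0 (x + h) - 2 * \<phi> 0 x + \<phi> 0 (x - h) - h^2 * \<phi> 2 x - h^4 / 12 * \<phi> 4 x\<bar> \<le> M / 360 * h^6" if "n = 6"
  proof -
    have "(\<Sum>m<6. (1 + (-1)^m) * \<phi> m x / fact m * h^m) = 2 * \<phi> 0 x + h^2 * \<phi> 2 x + h^4 / 12 * \<phi> 4 x"
      by (simp add: eval_nat_numeral)
    then show ?thesis using T that by (simp add: fact_numeral algebra_simps)
  qed
qed

text \<open>
  With \<open>\<delta>\<close> for the second difference, expand \<open>\<delta>\<phi>\<close> to sixth order and \<open>\<delta>\<phi>''\<close> to fourth order: both
  contain the fourth derivative with the factor \<open>h\<^sup>4/12\<close>, and it cancels. This is the compact identity underlying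
  Numerov's method. The sharper constant \<open>1/360 + 1/144\<close> is rounded up to one.
\<close>

lemma numerov:
  fixes \<phi> :: "nat \<Rightarrow> real \<Rightarrow> real"
  assumes "h > 0"
    and D: "\<And>m t. m < 6 \<Longrightarrow> x - h \<le> t \<Longrightarrow> t \<le> x + h \<Longrightarrow> (\<phi> m has_real_derivative \<phi> (Suc m) t) (at t)"
    and M: "\<And>t. x - h \<le> t \<Longrightarrow> t \<le> x + h \<Longrightarrow> \<bar>\<phi> 6 t\<bar> \<le> M"
  shows "\<bar>\<phi> 0 (x + h) - 2 * \<phi> 0 x + \<phi> 0 (x - h) - h^2 * \<phi> 2 x
            - h^2 / 12 * (\<phi> 2 (x + h) - 2 * \<phi> 2 x + \<phi> 2 (x - h))\<bar> \<le> M * h^6"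
proof -
  have A: "\<bar>\<phi> 0 (x + h) - 2 * \<phi> 0 x + \<phi> 0 (x - h) - h^2 * \<phi> 2 x - h^4 / 12 * \<phi> 4 x\<bar> \<le> M / 360 * h^6"
    using second_difference_estimates(3)[OF assms(1), where n = 6] D M by auto
  have "\<bar>\<phi> 2 (x + h) - 2 * \<phi> 2 x + \<phi> 2 (x - h) - h^2 * \<phi> 4 x\<bar> \<le> M / 12 * h^4"
    using second_difference_estimates(2)[OF assms(1), where n = 4 and \<phi> = "\<lambda>m. \<phi> (m + 2)" and x = x and M = M] D M
    by (auto simp: numeral_eq_Suc)
  from mult_left_mono[OF this, of "h^2 / 12"]
  have "\<bar>h^2 / 12 * (\<phi> 2 (x + h) - 2 * \<phi> 2 x + \<phi> 2 (x - h) - h^2 * \<phi> 4 x)\<bar> \<le> h^2 / 12 * (M / 12 * h^4)"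
    by (simp add: abs_mult)
  also have "h^2 / 12 * (\<phi> 2 (x + h) - 2 * \<phi> 2 x + \<phi> 2 (x - h) - h^2 * \<phi> 4 x)
      = h^2 / 12 * (\<phi> 2 (x + h) - 2 * \<phi> 2 x + \<phi> 2 (x - h)) - h^4 / 12 * \<phi> 4 x"
    by (simp add: right_diff_distrib power4_eq_xxxx power2_eq_square)
  also have "h^2 / 12 * (M / 12 * h^4) = M / 144 * h^6"
    by (simp flip: power_add)
  finally have B: "\<bar>h^2 / 12 * (\<phi> 2 (x + h) - 2 * \<phi> 2 x + \<phi> 2 (x - h)) - h^4 / 12 * \<phi> 4 x\<bar> \<le> M / 144 * h^6" .
  have "0 \<le> M" using M[of x] assms(1) by simp
  then have "M / 360 * h^6 + M / 144 * h^6 \<le> M * h^6"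
    by (simp flip: distrib_right)
  with A B show ?thesis by linarith
qed

section \<open>Functions that are smooth up to the boundary of the square\<close>

lemma closure_unit_square: "closure unit_square = {0..1} \<times> {0..1}"
  by (simp add: unit_square_def closure_Times)

lemma C_closure_continuous: "C_closure k S f \<Longrightarrow> continuous_on (closure S) f"
  by (cases k) auto

lemma C_closure_bounded:
  assumes "C_closure k unit_square f"
  shows "\<exists>M. \<forall>x\<in>{0..1}. \<forall>y\<in>{0..1}. \<bar>f (x, y)\<bar> \<le> M"
proof -
  have "compact (f ` ({0..1} \<times> {0..1}))"
    using C_closure_continuous[OF assms] unfolding closure_unit_square
    by (intro compact_continuous_image compact_Times) auto
  then obtain M where "\<forall>r\<in>f ` ({0..1} \<times> {0..1}). norm r \<le> M"
    using compact_imp_bounded bounded_iff by blast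
  then show ?thesis by (intro exI[of _ M]) auto
qed

text \<open>
  The class is symmetric in the coordinates, so that every estimate in the direction \<open>x\<close> also yields the one in
  the direction \<open>y\<close>.
\<close>

lemma C_closure_swap: "C_closure k unit_square f \<Longrightarrow> C_closure k unit_square (\<lambda>(x, y). f (y, x))"
proof (induction k arbitrary: f)
  case 0
  have "continuous_on ({0..1} \<times> {0..1}) (\<lambda>q. f (snd q, fst q))"
    using 0 unfolding C_closure.simps closure_unit_square
    by (intro continuous_on_compose2[of _ f _ "\<lambda>q. (snd q, fst q)"] continuous_intros) auto
  then show ?case by (simp add: closure_unit_square case_prod_unfold)
next
  case (Suc k)
  have "continuous_on ({0..1} \<times> {0..1}) (\<lambda>q. f (snd q, fst q))"
    using C_closure_continuous[OF Suc.prems] unfolding closure_unit_square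
    by (intro continuous_on_compose2[of _ f _ "\<lambda>q. (snd q, fst q)"] continuous_intros) auto
  then have cont: "continuous_on (closure unit_square) (\<lambda>(x, y). f (y, x))"
    by (simp add: closure_unit_square case_prod_unfold)
  from Suc.prems obtain fx fy where f: "C_closure k unit_square fx" "C_closure k unit_square fy"
    "\<forall>(x, y)\<in>unit_square. ((\<lambda>s. f (s, y)) has_real_derivative fx (x, y)) (at x) \<and>
                    ((\<lambda>t. f (x, t)) has_real_derivative fy (x, y)) (at y)"
    by auto
  show ?case
    unfolding C_closure.simps
    by (intro conjI cont exI[of _ "\<lambda>(x, y). fy (y, x)"] exI[of _ "\<lambda>(x, y). fx (y, x)"] Suc.IH f)
       (use f(3) in \<open>auto simp: unit_square_def\<close>)
qed

text \<open>
  Differentiating \<open>m\<close> times in \<open>x\<close> leaves \<open>k\<close> orders of smoothness, which remain available for derivatives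
  in the other direction.
\<close>

lemma C_closure_x_derivatives:
  assumes "C_closure (m + k) S f"
  shows "\<exists>D. D 0 = f \<and> (\<forall>i\<le>m. C_closure (m + k - i) S (D i)) \<and>
    (\<forall>i<m. \<forall>(x, y)\<in>S. ((\<lambda>s. D i (s, y)) has_real_derivative D (Suc i) (x, y)) (at x))"
  using assms
proof (induction m arbitrary: f)
  case 0
  then show ?case by (intro exI[of _ "\<lambda>_. f"]) auto
next
  case (Suc m)
  from Suc.prems obtain fx where fx: "C_closure (m + k) S fx"
    "\<forall>(x, y)\<in>S. ((\<lambda>s. f (s, y)) has_real_derivative fx (x, y)) (at x)"
    by fastforce
  from Suc.IH[OF fx(1)] obtain D where D: "D 0 = fx" "\<forall>i\<le>m. C_closure (m + k - i) S (D i)"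
    "\<forall>i<m. \<forall>(x, y)\<in>S. ((\<lambda>s. D i (s, y)) has_real_derivative D (Suc i) (x, y)) (at x)"
    by blast
  show ?case
    by (intro exI[of _ "case_nat f D"]) (use Suc.prems fx D in \<open>auto split: nat.splits\<close>)
qed

lemma second_difference_y_bound:
  assumes "C_closure 2 unit_square w"
  shows "\<exists>M. \<forall>x y h. 0 < x \<and> x < 1 \<and> 0 < h \<and> 0 < y - h \<and> y + h < 1 \<longrightarrow>
    \<bar>w (x, y + h) - 2 * w (x, y) + w (x, y - h)\<bar> \<le> M * h^2"
proof -
  obtain D where D: "D 0 = (\<lambda>(x, y). w (y, x))" "\<forall>i\<le>2. C_closure (2 - i) unit_square (D i)"
    "\<forall>i<2. \<forall>(x, y)\<in>unit_square. ((\<lambda>s. D i (s, y)) has_real_derivative D (Suc i) (x, y)) (at x)"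
    using C_closure_x_derivatives[of 2 0, simplified, OF C_closure_swap[OF assms]] by blast
  obtain M where M: "\<forall>x\<in>{0..1}. \<forall>y\<in>{0..1}. \<bar>D 2 (x, y)\<bar> \<le> M"
    using C_closure_bounded D(2) by blast
  show ?thesis
  proof (intro exI[of _ M] allI impI)
    fix x y h :: real
    assume *: "0 < x \<and> x < 1 \<and> 0 < h \<and> 0 < y - h \<and> y + h < 1"
    have "\<bar>D 0 (y + h, x) - 2 * D 0 (y, x) + D 0 (y - h, x)\<bar> \<le> M * h^2"
      by (rule second_difference_estimates(1)[where \<phi> = "\<lambda>m t. D m (t, x)" and n = 2])
         (use * D(3) M in \<open>auto simp: unit_square_def\<close>)
    then show "\<bar>w (x, y + h) - 2 * w (x, y) + w (x, y - h)\<bar> \<le> M * h^2"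
      by (simp add: D(1))
  qed
qed

section \<open>Consistency of fourth order\<close>

definition diff2_x :: "real \<Rightarrow> (real \<times> real \<Rightarrow> real) \<Rightarrow> real \<times> real \<Rightarrow> real" where
  "diff2_x h w = (\<lambda>(x, y). w (x + h, y) - 2 * w (x, y) + w (x - h, y))"

definition diff2_y :: "real \<Rightarrow> (real \<times> real \<Rightarrow> real) \<Rightarrow> real \<times> real \<Rightarrow> real" where
  "diff2_y h w = (\<lambda>(x, y). w (x, y + h) - 2 * w (x, y) + w (x, y - h))"

text \<open>
  The second estimate, on the mixed second difference, expands the function \<open>s \<mapsto> \<delta>\<^sub>y w(s, y)\<close>, where \<open>\<delta>\<^sub>y\<close> is the
  second difference in \<open>y\<close>. Differentiation in \<open>x\<close> commutes with \<open>\<delta>\<^sub>y\<close> trivially, so the remainder is the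
  second difference in \<open>y\<close> of \<open>w\<^sub>x\<^sub>x\<^sub>x\<^sub>x\<close>; as this function is twice differentiable in \<open>y\<close>, another factor \<open>h\<^sup>2\<close> is gained
  without interchanging mixed derivatives. The stencil stays inside the open square, where the derivatives exist.
\<close>

lemma directional_consistency:
  assumes "C_closure 6 unit_square w"
  shows "\<exists>wxx K. continuous_on (closure unit_square) wxx \<and>
    (\<forall>(x, y)\<in>unit_square. deriv (deriv (\<lambda>s. w (s, y))) x = wxx (x, y)) \<and>
    (\<forall>x y h. 0 < h \<and> 0 < x - h \<and> x + h < 1 \<and> 0 < y - h \<and> y + h < 1 \<longrightarrow>
      \<bar>diff2_x h w (x, y) - h^2 * wxx (x, y) - h^2 / 12 * diff2_x h wxx (x, y)\<bar> \<le> K * h^6 \<and>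
      \<bar>diff2_x h (diff2_y h w) (x, y) - h^2 * diff2_y h wxx (x, y)\<bar> \<le> K * h^6)"
proof -
  obtain D where D: "D 0 = w" "\<forall>i\<le>6. C_closure (6 - i) unit_square (D i)"
    "\<forall>i<6. \<forall>(x, y)\<in>unit_square. ((\<lambda>s. D i (s, y)) has_real_derivative D (Suc i) (x, y)) (at x)"
    using C_closure_x_derivatives[of 6 0, simplified, OF assms] by blast
  obtain M where M: "\<forall>x\<in>{0..1}. \<forall>y\<in>{0..1}. \<bar>D 6 (x, y)\<bar> \<le> M"
    using C_closure_bounded D(2) by blast
  have "C_closure 2 unit_square (D 4)" using D(2)[rule_format, of 4] by simp
  then obtain M' where M': "\<And>x y h. 0 < x \<and> x < 1 \<and> 0 < h \<and> 0 < y - h \<and> y + h < 1 \<Longrightarrow>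
    \<bar>D 4 (x, y + h) - 2 * D 4 (x, y) + D 4 (x, y - h)\<bar> \<le> M' * h^2"
    using second_difference_y_bound by blast
  have deriv: "deriv (\<lambda>s. D i (s, y)) x = D (Suc i) (x, y)" if "i < 6" "(x, y) \<in> unit_square" for i x y
    using D(3) that by (intro DERIV_imp_deriv) auto
  have dd: "deriv (deriv (\<lambda>s. w (s, y))) x = D 2 (x, y)" if xy: "(x, y) \<in> unit_square" for x y
  proof -
    have "\<forall>\<^sub>F s in nhds x. s \<in> {0<..<1}"
      using xy by (intro eventually_nhds_in_open) (auto simp: unit_square_def)
    then have "\<forall>\<^sub>F s in nhds x. deriv (\<lambda>s. w (s, y)) s = D 1 (s, y)"
      by eventually_elim (use deriv[of 0] xy D(1) in \<open>auto simp: unit_square_def\<close>)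
    then have "deriv (deriv (\<lambda>s. w (s, y))) x = deriv (\<lambda>s. D 1 (s, y)) x"
      by (intro deriv_cong_ev) auto
    with deriv[OF _ xy, of 1] show ?thesis by (simp add: numeral_2_eq_2)
  qed
  define K where "K = max M (M' / 12)"
  have main: "\<bar>diff2_x h w (x, y) - h^2 * D 2 (x, y) - h^2 / 12 * diff2_x h (D 2) (x, y)\<bar> \<le> K * h^6 \<and>
      \<bar>diff2_x h (diff2_y h w) (x, y) - h^2 * diff2_y h (D 2) (x, y)\<bar> \<le> K * h^6"
    if *: "0 < h \<and> 0 < x - h \<and> x + h < 1 \<and> 0 < y - h \<and> y + h < 1" for x y h
  proof
    have K: "M * h^6 \<le> K * h^6" "M' / 12 * h^6 \<le> K * h^6"
      unfolding K_def using * by (intro mult_right_mono; simp)+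
    have "\<bar>D 0 (x + h, y) - 2 * D 0 (x, y) + D 0 (x - h, y) - h^2 * D 2 (x, y)
        - h^2 / 12 * (D 2 (x + h, y) - 2 * D 2 (x, y) + D 2 (x - h, y))\<bar> \<le> M * h^6"
      by (rule numerov[where \<phi> = "\<lambda>m t. D m (t, y)"])
         (use * D(3) M in \<open>auto simp: unit_square_def\<close>)
    with K show "\<bar>diff2_x h w (x, y) - h^2 * D 2 (x, y) - h^2 / 12 * diff2_x h (D 2) (x, y)\<bar> \<le> K * h^6"
      by (simp add: D(1) diff2_x_def)
    define \<phi> where "\<phi> m s = diff2_y h (D m) (s, y)" for m s
    have "\<bar>\<phi> 0 (x + h) - 2 * \<phi> 0 x + \<phi> 0 (x - h) - h^2 * \<phi> 2 x\<bar> \<le> (M' * h^2) / 12 * h^4"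
    proof (rule second_difference_estimates(2)[where n = 4])
      show "(\<phi> m has_real_derivative \<phi> (Suc m) t) (at t)" if "m < 4" "x - h \<le> t" "t \<le> x + h" for m t
        unfolding \<phi>_def diff2_y_def case_prod_conv
        by (intro DERIV_add DERIV_diff DERIV_cmult) (use D(3) that * in \<open>auto simp: unit_square_def\<close>)
      show "\<bar>\<phi> 4 t\<bar> \<le> M' * h^2" if "x - h \<le> t" "t \<le> x + h" for t
        using M'[of t h y] that * by (simp add: \<phi>_def diff2_y_def)
    qed (use * in auto)
    also have "(M' * h^2) / 12 * h^4 = M' / 12 * h^6" by (simp flip: power_add)
    finally show "\<bar>diff2_x h (diff2_y h w) (x, y) - h^2 * diff2_y h (D 2) (x, y)\<bar> \<le> K * h^6"
      using K by (simp add: \<phi>_def D(1) diff2_x_def)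
  qed
  have "continuous_on (closure unit_square) (D 2)"
    using D(2)[rule_format, of 2] by (intro C_closure_continuous) auto
  with dd main show ?thesis by blast
qed

text \<open>
  The left side splits into the one-dimensional errors in the two directions and one twelfth of the two mixed
  errors. A stencil that touches the boundary is the limit of the interior stencils with the same centre
  and smaller mesh size \<open>h\<close>; both sides are continuous in \<open>h\<close>, hence the bound persists in the limit.
\<close>

lemma nine_point_consistency:
  assumes "C_closure 6 unit_square w"
  shows "\<exists>Lw K. continuous_on (closure unit_square) Lw \<and> (\<forall>P\<in>unit_square. laplacian w P = Lw P) \<and> 0 \<le> K \<and>
    (\<forall>x y h. 0 < h \<and> 0 \<le> x - h \<and> x + h \<le> 1 \<and> 0 \<le> y - h \<and> y + h \<le> 1 \<longrightarrow>
      \<bar>diff2_x h w (x, y) + diff2_y h w (x, y) + diff2_x h (diff2_y h w) (x, y) / 6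
        - h^2 * Lw (x, y) - h^2 / 12 * (diff2_x h Lw (x, y) + diff2_y h Lw (x, y))\<bar> \<le> K * h^6)"
proof -
  obtain wxx K1 where 1: "continuous_on (closure unit_square) wxx"
    "\<And>x y. (x, y)\<in>unit_square \<Longrightarrow> deriv (deriv (\<lambda>s. w (s, y))) x = wxx (x, y)"
    "\<And>x y h. 0 < h \<and> 0 < x - h \<and> x + h < 1 \<and> 0 < y - h \<and> y + h < 1 \<Longrightarrow>
      \<bar>diff2_x h w (x, y) - h^2 * wxx (x, y) - h^2 / 12 * diff2_x h wxx (x, y)\<bar> \<le> K1 * h^6 \<and>
      \<bar>diff2_x h (diff2_y h w) (x, y) - h^2 * diff2_y h wxx (x, y)\<bar> \<le> K1 * h^6"
    using directional_consistency[OF assms] by blast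
  let ?w' = "\<lambda>(x, y). w (y, x)"
  obtain wyy' K2 where 2: "continuous_on (closure unit_square) wyy'"
    "\<And>x y. (x, y)\<in>unit_square \<Longrightarrow> deriv (deriv (\<lambda>s. ?w' (s, y))) x = wyy' (x, y)"
    "\<And>x y h. 0 < h \<and> 0 < x - h \<and> x + h < 1 \<and> 0 < y - h \<and> y + h < 1 \<Longrightarrow>
      \<bar>diff2_x h ?w' (x, y) - h^2 * wyy' (x, y) - h^2 / 12 * diff2_x h wyy' (x, y)\<bar> \<le> K2 * h^6 \<and>
      \<bar>diff2_x h (diff2_y h ?w') (x, y) - h^2 * diff2_y h wyy' (x, y)\<bar> \<le> K2 * h^6"
    using directional_consistency[OF C_closure_swap[OF assms]] by blast
  define wyy where "wyy = (\<lambda>(x, y). wyy' (y, x))"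
  have wyy: "continuous_on (closure unit_square) wyy"
    using C_closure_swap[of 0 wyy'] 2(1) by (simp add: wyy_def)
  define Lw where "Lw P = wxx P + wyy P" for P
  have cont_Lw: "continuous_on (closure unit_square) Lw"
    unfolding Lw_def by (intro continuous_on_add 1(1) wyy)
  have lap: "laplacian w P = Lw P" if "P \<in> unit_square" for P
  proof -
    obtain x y where P: "P = (x, y)" by (cases P)
    show ?thesis
      using 1(2)[of x y] 2(2)[of y x] that
      by (auto simp: P unit_square_def laplacian_def Lw_def wyy_def)
  qed
  define E where "E x y h = diff2_x h w (x, y) + diff2_y h w (x, y) + diff2_x h (diff2_y h w) (x, y) / 6
        - h^2 * Lw (x, y) - h^2 / 12 * (diff2_x h Lw (x, y) + diff2_y h Lw (x, y))" for x y h
  define K where "K = max 0 (13 / 12 * (K1 + K2))"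
  have interior: "\<bar>E x y h\<bar> \<le> K * h^6"
    if *: "0 < h \<and> 0 < x - h \<and> x + h < 1 \<and> 0 < y - h \<and> y + h < 1" for x y h
  proof -
    let ?P1 = "diff2_x h w (x, y) - h^2 * wxx (x, y) - h^2 / 12 * diff2_x h wxx (x, y)"
    let ?P2 = "diff2_y h w (x, y) - h^2 * wyy (x, y) - h^2 / 12 * diff2_y h wyy (x, y)"
    let ?Q1 = "diff2_x h (diff2_y h w) (x, y) - h^2 * diff2_y h wxx (x, y)"
    let ?Q2 = "diff2_x h (diff2_y h w) (x, y) - h^2 * diff2_x h wyy (x, y)"
    have "E x y h = ?P1 + ?P2 + ?Q1 / 12 + ?Q2 / 12"
      by (simp add: E_def diff2_x_def diff2_y_def Lw_def field_simps)
    moreover have "\<bar>?P1\<bar> \<le> K1 * h^6" "\<bar>?Q1\<bar> \<le> K1 * h^6" using 1(3)[OF *] by auto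
    moreover have "\<bar>?P2\<bar> \<le> K2 * h^6" "\<bar>?Q2\<bar> \<le> K2 * h^6"
      using 2(3)[of h y x] * by (auto simp: diff2_x_def diff2_y_def wyy_def algebra_simps)
    moreover have "\<bar>a + b + c / 12 + d / 12\<bar> \<le> 13 / 12 * A + 13 / 12 * B"
      if "\<bar>a\<bar> \<le> A" "\<bar>c\<bar> \<le> A" "\<bar>b\<bar> \<le> B" "\<bar>d\<bar> \<le> B" for a b c d A B :: real
      using that[THEN abs_le_D1] that[THEN abs_le_D2] by (intro abs_leI; linarith)
    ultimately have "\<bar>E x y h\<bar> \<le> 13 / 12 * (K1 * h^6) + 13 / 12 * (K2 * h^6)"
      by presburger
    then have "\<bar>E x y h\<bar> \<le> 13 / 12 * (K1 + K2) * h^6"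
      by (simp add: algebra_simps)
    also have "\<dots> \<le> K * h^6" unfolding K_def using * by (intro mult_right_mono) auto
    finally show ?thesis .
  qed
  have "\<bar>E x y H\<bar> \<le> K * H^6"
    if *: "0 < H \<and> 0 \<le> x - H \<and> x + H \<le> 1 \<and> 0 \<le> y - H \<and> y + H \<le> 1" for x y H
  proof -
    have point: "continuous_on {0..H} (\<lambda>h. g (x + a * h, y + b * h))"
      if g: "continuous_on (closure unit_square) g" and "a \<in> {-1, 0, 1}" "b \<in> {-1, 0, 1}"
      for g :: "real \<times> real \<Rightarrow> real" and a b :: real
      using that(2,3) *
      by (intro continuous_on_compose2[OF g] continuous_intros) (auto simp: closure_unit_square)
    note w = C_closure_continuous[OF assms]
    note pw = point[OF w, of 1 0] point[OF w, of "-1" 0] point[OF w, of 0 1] point[OF w, of 0 "-1"]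
      point[OF w, of 1 1] point[OF w, of 1 "-1"] point[OF w, of "-1" 1] point[OF w, of "-1" "-1"]
    note pL = point[OF cont_Lw, of 1 0] point[OF cont_Lw, of "-1" 0] point[OF cont_Lw, of 0 1] point[OF cont_Lw, of 0 "-1"]
    have "continuous_on {0..H} (E x y)"
      using pw pL unfolding E_def[abs_def] diff2_x_def diff2_y_def case_prod_conv
      by (intro continuous_intros) auto
    then have "continuous_on (closure {0<..<H}) (\<lambda>h. \<bar>E x y h\<bar> - K * h^6)"
      using * by (auto intro!: continuous_intros)
    then have "\<bar>E x y H\<bar> - K * H^6 \<le> 0"
      by (rule continuous_le_on_closure) (use interior[of _ x y] * in auto)
    then show ?thesis by simp
  qed
  moreover have "0 \<le> K" by (simp add: K_def)
  ultimately show ?thesis using cont_Lw lap unfolding E_def by blast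
qed

lemma node_in_closed_square:
  assumes "i \<le> N" "j \<le> N"
  shows "(real i / real N, real j / real N) \<in> closure unit_square"
  using assms by (auto simp: closure_unit_square divide_le_eq_1)

lemma grid_values_boundary:
  assumes "\<forall>P\<in>frontier unit_square. w P = 0" "i \<le> N" "j \<le> N" "N > 0"
    and "\<not> (i \<in> {1..N-1} \<and> j \<in> {1..N-1})"
  shows "grid_values N w i j = 0"
proof -
  have "i = 0 \<or> i = N \<or> j = 0 \<or> j = N" using assms by auto
  then have "(real i / real N, real j / real N) \<notin> interior unit_square"
    using assms(4) by (auto simp: unit_square_def interior_Times interior_open)
  then show ?thesis
    using assms(1) node_in_closed_square[OF assms(2,3)] by (simp add: grid_values_def frontier_def)
qed

text \<open>
  Here \<open>Lw\<close> is the continuous extension of the Laplacian of \<open>w\<close> to the closed square; \<open>R\<^sub>h\<close> reads it also at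
  boundary nodes.
\<close>

lemma scheme_consistency:
  assumes "C_closure 6 unit_square w"
  shows "\<exists>Lw K. continuous_on (closure unit_square) Lw \<and> (\<forall>P\<in>unit_square. laplacian w P = Lw P) \<and> 0 \<le> K \<and>
    (\<forall>N i j. i \<in> {1..N-1} \<and> j \<in> {1..N-1} \<longrightarrow>
      \<bar>F_h N (grid_values N w) i j + R_h (grid_values N Lw) i j\<bar> \<le> K * (1 / real N)^4)"
proof -
  obtain Lw K where L: "continuous_on (closure unit_square) Lw" "\<forall>P\<in>unit_square. laplacian w P = Lw P" "0 \<le> K"
    "\<And>x y h. 0 < h \<and> 0 \<le> x - h \<and> x + h \<le> 1 \<and> 0 \<le> y - h \<and> y + h \<le> 1 \<Longrightarrow>
      \<bar>diff2_x h w (x, y) + diff2_y h w (x, y) + diff2_x h (diff2_y h w) (x, y) / 6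
        - h^2 * Lw (x, y) - h^2 / 12 * (diff2_x h Lw (x, y) + diff2_y h Lw (x, y))\<bar> \<le> K * h^6"
    using nine_point_consistency[OF assms] by blast
  have "\<bar>F_h N (grid_values N w) i j + R_h (grid_values N Lw) i j\<bar> \<le> K * (1 / real N)^4"
    if ij: "i \<in> {1..N-1} \<and> j \<in> {1..N-1}" for N i j
  proof -
    define h x y where "h = 1 / real N" and "x = real i / real N" and "y = real j / real N"
    have "N > 0" using ij by (cases N) auto
    then have "h > 0" by (simp add: h_def)
    have node: "real (i+1) / real N = x + h" "real (i-1) / real N = x - h"
      "real (j+1) / real N = y + h" "real (j-1) / real N = y - h"
      using ij by (auto simp: h_def x_def y_def of_nat_diff add_divide_distrib diff_divide_distrib)
    have "0 \<le> real (i-1) / real N" "real (i+1) / real N \<le> 1" "0 \<le> real (j-1) / real N" "real (j+1) / real N \<le> 1"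
      using ij by (auto simp: divide_le_eq_1)
    then have inside: "0 < h \<and> 0 \<le> x - h \<and> x + h \<le> 1 \<and> 0 \<le> y - h \<and> y + h \<le> 1"
      unfolding node using \<open>h > 0\<close> by blast
    let ?r = "F_h N (grid_values N w) i j + R_h (grid_values N Lw) i j"
    have gv: "grid_values N g i j = g (x, y)" "grid_values N g (i+1) j = g (x + h, y)" "grid_values N g (i-1) j = g (x - h, y)"
      "grid_values N g i (j+1) = g (x, y + h)" "grid_values N g i (j-1) = g (x, y - h)"
      "grid_values N g (i+1) (j+1) = g (x + h, y + h)" "grid_values N g (i+1) (j-1) = g (x + h, y - h)"
      "grid_values N g (i-1) (j+1) = g (x - h, y + h)" "grid_values N g (i-1) (j-1) = g (x - h, y - h)" for g
      unfolding grid_values_def node by (simp_all add: x_def y_def)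
    have "h^2 * ?r = - (diff2_x h w (x, y) + diff2_y h w (x, y) + diff2_x h (diff2_y h w) (x, y) / 6
        - h^2 * Lw (x, y) - h^2 / 12 * (diff2_x h Lw (x, y) + diff2_y h Lw (x, y)))"
      unfolding F_h_def R_h_def gv h_def[symmetric] diff2_x_def diff2_y_def case_prod_conv
      using \<open>h > 0\<close> by (simp add: field_simps)
    then have "\<bar>h^2 * ?r\<bar> \<le> K * h^6" using L(4)[OF inside] by simp
    then have "h^2 * \<bar>?r\<bar> \<le> h^2 * (K * h^4)"
      by (simp add: abs_mult mult.left_commute flip: power_add)
    then show ?thesis using \<open>h > 0\<close> by (simp add: h_def[symmetric])
  qed
  with L(1-3) show ?thesis by blast
qed

section \<open>Convergence of fourth order\<close>

lemma grid_norm_le: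
  assumes "N \<ge> 2" "\<And>i j. i \<in> {1..N-1} \<Longrightarrow> j \<in> {1..N-1} \<Longrightarrow> \<bar>v i j\<bar> \<le> B"
  shows "grid_norm N v \<le> B"
  unfolding grid_norm_def using assms by (subst Max_le_iff) auto

text \<open>
  Identities that the optimality system asserts in the open square hold at boundary nodes as well.
\<close>

lemma grid_values_continuous_extension:
  assumes "continuous_on (closure unit_square) f" "continuous_on (closure unit_square) f'"
    and "\<forall>P\<in>unit_square. f P = f' P" "i \<le> N" "j \<le> N"
  shows "grid_values N f i j = grid_values N f' i j"
  using continuous_constant_on_closure[of unit_square "\<lambda>P. f P - f' P" 0] assms
    node_in_closed_square[OF assms(4,5)]
  by (auto simp: grid_values_def intro!: continuous_on_diff)

theorem theorem2p2:
  fixes \<alpha> :: real and z u p f g :: "real \<times> real \<Rightarrow> real"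
  assumes "\<alpha> > 0"
    and "continuous_on (closure unit_square) f"
    and "continuous_on (closure unit_square) g"
    and "optimality_system \<alpha> f g z u p"
    and "C_closure 6 unit_square z"
    and "C_closure 6 unit_square u"
    and "C_closure 6 unit_square p"
  shows "\<exists>C>0. \<forall>N\<ge>2.
    (\<exists>!(z\<^sub>h, u\<^sub>h, p\<^sub>h). scheme_solution N \<alpha> f g z\<^sub>h u\<^sub>h p\<^sub>h) \<and>
    (\<forall>z\<^sub>h u\<^sub>h p\<^sub>h. scheme_solution N \<alpha> f g z\<^sub>h u\<^sub>h p\<^sub>h \<longrightarrow>
       grid_norm N (\<lambda>i j. grid_values N z i j - z\<^sub>h i j) \<le> C * (1 / real N)^4 \<and>
       grid_norm N (\<lambda>i j. grid_values N u i j - u\<^sub>h i j) \<le> C * (1 / real N)^4 \<and>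
       grid_norm N (\<lambda>i j. grid_values N p i j - p\<^sub>h i j) \<le> C * (1 / real N)^4)"
proof -
  note cz = C_closure_continuous[OF assms(5)] and cu = C_closure_continuous[OF assms(6)]
    and cp = C_closure_continuous[OF assms(7)]
  have sys: "\<forall>P\<in>unit_square. - laplacian z P - u P = f P" "\<forall>P\<in>frontier unit_square. z P = 0"
    "\<forall>P\<in>unit_square. - laplacian p P + z P = g P" "\<forall>P\<in>frontier unit_square. p P = 0"
    "\<forall>P\<in>unit_square. \<alpha> * u P = p P"
    using assms(4) by (auto simp: optimality_system_def)
  obtain Lz K1 where Lz: "continuous_on (closure unit_square) Lz" "\<forall>P\<in>unit_square. laplacian z P = Lz P" "0 \<le> K1"
    "\<And>N i j. i \<in> {1..N-1} \<Longrightarrow> j \<in> {1..N-1} \<Longrightarrow>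
      \<bar>F_h N (grid_values N z) i j + R_h (grid_values N Lz) i j\<bar> \<le> K1 * (1 / real N)^4"
    using scheme_consistency[OF assms(5)] by blast
  obtain Lp K2 where Lp: "continuous_on (closure unit_square) Lp" "\<forall>P\<in>unit_square. laplacian p P = Lp P" "0 \<le> K2"
    "\<And>N i j. i \<in> {1..N-1} \<Longrightarrow> j \<in> {1..N-1} \<Longrightarrow>
      \<bar>F_h N (grid_values N p) i j + R_h (grid_values N Lp) i j\<bar> \<le> K2 * (1 / real N)^4"
    using scheme_consistency[OF assms(7)] by blast
  define K where "K = K1 + K2"
  \<comment> \<open>The maximum norms of the errors in \<open>z\<close>, \<open>u\<close> and \<open>p\<close> carry the factors \<open>1 / sqrt \<alpha>\<close>, \<open>1 / \<alpha>\<close> and \<open>1\<close>;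
     their sum serves all three.\<close>
  define S where "S = 3 * sqrt ((\<alpha> + 1) / 4) * (1 + 1 / sqrt \<alpha> + 1 / \<alpha>)"
  \<comment> \<open>Adding one keeps the constant positive when the truncation error vanishes.\<close>
  define C where "C = S * K + 1"
  have S: "0 \<le> S" unfolding S_def using assms(1) by simp
  have K: "0 \<le> K" using Lz(3) Lp(3) by (simp add: K_def)
  have error: "\<bar>grid_values N z i j - z\<^sub>h i j\<bar> \<le> C * (1 / real N)^4 \<and>
      \<bar>grid_values N u i j - u\<^sub>h i j\<bar> \<le> C * (1 / real N)^4 \<and>
      \<bar>grid_values N p i j - p\<^sub>h i j\<bar> \<le> C * (1 / real N)^4"
    if N: "N \<ge> 2" and sol: "scheme_solution N \<alpha> f g z\<^sub>h u\<^sub>h p\<^sub>h" and ij: "i \<in> {1..N-1}" "j \<in> {1..N-1}"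
    for N z\<^sub>h u\<^sub>h p\<^sub>h i j
  proof -
    define T where "T = K * (1 / real N)^4"
    have T: "0 \<le> T" using K by (simp add: T_def)
    \<comment> \<open>The values of the exact solution at indices beyond \<open>N\<close> are arbitrary; cutting them off makes the errors
       grid functions and leaves the stencils at interior nodes unchanged.\<close>
    define G where "G v = (\<lambda>i j. if i \<le> N \<and> j \<le> N then v i j else 0)" for v :: grid
    define e\<^sub>z where "e\<^sub>z = G (\<lambda>i j. grid_values N z i j - z\<^sub>h i j)"
    define e\<^sub>u where "e\<^sub>u = G (\<lambda>i j. grid_values N u i j - u\<^sub>h i j)"
    define e\<^sub>p where "e\<^sub>p = G (\<lambda>i j. grid_values N p i j - p\<^sub>h i j)"
    have gv_f: "grid_values N f i j = - grid_values N Lz i j - grid_values N u i j"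
      and gv_g: "grid_values N g i j = - grid_values N Lp i j + grid_values N z i j"
      and gv_u: "\<alpha> * grid_values N u i j = grid_values N p i j"
      if "i \<le> N" "j \<le> N" for i j
    proof -
      have "grid_values N f i j = grid_values N (\<lambda>P. - Lz P - u P) i j"
        by (rule grid_values_continuous_extension[OF assms(2) _ _ that])
           (use Lz sys cu in \<open>auto intro!: continuous_intros\<close>)
      then show "grid_values N f i j = - grid_values N Lz i j - grid_values N u i j"
        by (simp add: grid_values_def)
      have "grid_values N g i j = grid_values N (\<lambda>P. - Lp P + z P) i j"
        by (rule grid_values_continuous_extension[OF assms(3) _ _ that])
           (use Lp sys cz in \<open>auto intro!: continuous_intros\<close>)
      then show "grid_values N g i j = - grid_values N Lp i j + grid_values N z i j"
        by (simp add: grid_values_def)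
      have "grid_values N (\<lambda>P. \<alpha> * u P) i j = grid_values N p i j"
        by (rule grid_values_continuous_extension[OF _ cp _ that])
           (use sys cu in \<open>auto intro!: continuous_intros\<close>)
      then show "\<alpha> * grid_values N u i j = grid_values N p i j"
        by (simp add: grid_values_def)
    qed
    have bd: "grid_values N z i j = 0" "grid_values N p i j = 0" "grid_values N u i j = 0"
      if "i \<le> N" "j \<le> N" "\<not> (i \<in> {1..N-1} \<and> j \<in> {1..N-1})" for i j
      using grid_values_boundary[OF sys(2) that(1,2) _ that(3)] grid_values_boundary[OF sys(4) that(1,2) _ that(3)]
        gv_u[OF that(1,2)] N assms(1) by auto
    have sol_grid: "z\<^sub>h \<in> grid_functions N" "u\<^sub>h \<in> grid_functions N" "p\<^sub>h \<in> grid_functions N"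
      using sol by (auto simp: scheme_solution_def)
    have grid: "e\<^sub>z \<in> grid_functions N" "e\<^sub>u \<in> grid_functions N" "e\<^sub>p \<in> grid_functions N"
      unfolding e\<^sub>z_def e\<^sub>u_def e\<^sub>p_def G_def using bd sol_grid by (auto simp: grid_functions_def)
    have F_G: "F_h N (G v) i j = F_h N v i j" and R_G: "R_h (G v) i j = R_h v i j"
      if "i \<in> {1..N-1}" "j \<in> {1..N-1}" for v i j
    proof -
      have "i \<le> N" "j \<le> N" "i + 1 \<le> N" "j + 1 \<le> N" "i - 1 \<le> N" "j - 1 \<le> N" using that by auto
      then show "F_h N (G v) i j = F_h N v i j" "R_h (G v) i j = R_h v i j"
        by (simp_all add: F_h_def R_h_def G_def)
    qed
    have state: "\<bar>F_h N e\<^sub>z i j - R_h e\<^sub>u i j\<bar> \<le> T" and adjoint: "\<bar>F_h N e\<^sub>p i j + R_h e\<^sub>z i j\<bar> \<le> T"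
      and gradient: "\<alpha> * e\<^sub>u i j = e\<^sub>p i j"
      if ij: "i \<in> {1..N-1}" "j \<in> {1..N-1}" for i j
    proof -
      have le: "i + 1 \<le> N" "j + 1 \<le> N" using ij by auto
      have eqs: "F_h N z\<^sub>h i j - R_h u\<^sub>h i j = R_h (grid_values N f) i j"
        "F_h N p\<^sub>h i j + R_h z\<^sub>h i j = R_h (grid_values N g) i j" "\<alpha> * u\<^sub>h i j = p\<^sub>h i j"
        using sol ij by (auto simp: scheme_solution_def)
      have Rf: "R_h (grid_values N f) i j = - R_h (grid_values N Lz) i j - R_h (grid_values N u) i j"
        and Rg: "R_h (grid_values N g) i j = - R_h (grid_values N Lp) i j + R_h (grid_values N z) i j"
        using le by (simp_all add: R_h_def gv_f gv_g field_simps)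
      have KT: "K1 * (1 / real N)^4 \<le> T" "K2 * (1 / real N)^4 \<le> T"
        unfolding T_def K_def using Lz(3) Lp(3) by (intro mult_right_mono; simp)+
      have "F_h N e\<^sub>z i j - R_h e\<^sub>u i j = F_h N (grid_values N z) i j + R_h (grid_values N Lz) i j"
        unfolding e\<^sub>z_def e\<^sub>u_def F_G[OF ij] R_G[OF ij] stencils_linear using eqs(1) Rf by linarith
      then show "\<bar>F_h N e\<^sub>z i j - R_h e\<^sub>u i j\<bar> \<le> T" using Lz(4)[OF ij] KT by simp
      have "F_h N e\<^sub>p i j + R_h e\<^sub>z i j = F_h N (grid_values N p) i j + R_h (grid_values N Lp) i j"
        unfolding e\<^sub>z_def e\<^sub>p_def F_G[OF ij] R_G[OF ij] stencils_linear using eqs(2) Rg by linarith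
      then show "\<bar>F_h N e\<^sub>p i j + R_h e\<^sub>z i j\<bar> \<le> T" using Lp(4)[OF ij] KT by simp
      show "\<alpha> * e\<^sub>u i j = e\<^sub>p i j"
        using eqs(3) gv_u[of i j] le by (simp add: e\<^sub>u_def e\<^sub>p_def G_def right_diff_distrib)
    qed
    have le: "i \<le> N" "j \<le> N" using ij by auto
    have "N > 0" using N by simp
    note stab = scheme_stability[OF assms(1) \<open>N > 0\<close> grid state adjoint gradient le]
    define q where "q = 3 * sqrt ((\<alpha> + 1) / 4)"
    have q: "0 \<le> q" "q\<^sup>2 = 9 * (\<alpha> + 1) / 4" using assms(1) by (simp_all add: q_def power_mult_distrib)
    have "(sqrt \<alpha> * e\<^sub>z i j)\<^sup>2 \<le> (q * T)\<^sup>2" "(e\<^sub>p i j)\<^sup>2 \<le> (q * T)\<^sup>2"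
      using stab assms(1) by (simp_all add: power_mult_distrib q(2))
    then have "\<bar>sqrt \<alpha> * e\<^sub>z i j\<bar> \<le> q * T" and ep: "\<bar>e\<^sub>p i j\<bar> \<le> q * T"
      using q(1) T by (simp_all add: abs_le_square_iff[symmetric])
    then have ez: "\<bar>e\<^sub>z i j\<bar> \<le> q * T / sqrt \<alpha>"
      using assms(1) by (simp add: abs_mult field_simps)
    have "\<alpha> * \<bar>e\<^sub>u i j\<bar> = \<bar>e\<^sub>p i j\<bar>"
      using gradient[OF ij] assms(1) by (metis abs_mult abs_of_pos)
    with ep have eu: "\<bar>e\<^sub>u i j\<bar> \<le> q * T / \<alpha>" using assms(1) by (simp add: field_simps)
    have "q * T + q * T / sqrt \<alpha> + q * T / \<alpha> = S * K * (1 / real N)^4"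
      by (simp add: S_def q_def T_def algebra_simps)
    also have "\<dots> \<le> C * (1 / real N)^4"
      unfolding C_def by (intro mult_right_mono) auto
    finally have "q * T + q * T / sqrt \<alpha> + q * T / \<alpha> \<le> C * (1 / real N)^4" .
    moreover have "0 \<le> q * T" "0 \<le> q * T / sqrt \<alpha>" "0 \<le> q * T / \<alpha>" using q(1) T assms(1) by auto
    ultimately have "\<bar>e\<^sub>z i j\<bar> \<le> C * (1 / real N)^4" "\<bar>e\<^sub>u i j\<bar> \<le> C * (1 / real N)^4" "\<bar>e\<^sub>p i j\<bar> \<le> C * (1 / real N)^4"
      using ez eu ep by linarith+
    then show ?thesis using le by (simp add: e\<^sub>z_def e\<^sub>u_def e\<^sub>p_def G_def)
  qed
  have "C > 0" using S K by (simp add: C_def add_nonneg_pos)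
  then show ?thesis
    using scheme_uniquely_solvable[OF assms(1)] error
    by (intro exI[of _ C] conjI allI impI grid_norm_le) auto
qed

end
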